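(* Let $s,\beta>0$ and let $\varepsilon_1,\varepsilon_2\in(0,1)$. (1) There exists a constant $C>0$ such that for every measurable $S\subset\Omega$ with $0<\mu(S)<\infty$ and every $f\in L^1(\Omega,\mu)\cap L^2(\Omega,\mu)$ which is $\varepsilon_1$-timelimited on $S$, $$\mu(S)^{\frac{a+\beta}{2a}}\,\||\xi|^{\beta}\mathcal{T}f\|_{2,\mu}\ge C(1-\varepsilon_1)^{\frac{a+\beta}{a}}\|f\|_{1,\mu}.$$ (2) There exists a constant $C>0$ such that for every measurable $\Sigma\subset\Omega$ with $0<\mu(\Sigma)<\infty$ and every $f\in L^1(\Omega,\mu)\cap L^2(\Omega,\mu)$ which is $\varepsilon_2$-bandlimited on $\Sigma$, $$\mu(\Sigma)^{\frac{a+s}{2a}}\,\||x|^{s}f\|_{1,\mu}\ge C(1-\varepsilon_2^2)^{\frac{a+s}{2a}}\|f\|_{2,\mu}.$$ (3) There exists a constant $C>0$ such that for all such $S,\Sigma$ and every $f\in L^1\cap L^2(\varepsilon_1,\varepsilon_2,S,\Sigma)$, $$\||x|^{s}f\|_{1,\mu}^{a+\beta}\,\||\xi|^{\beta}\mathcal{T}f\|_{2,\mu}^{a+s}\ge C\left(\frac{(1-\varepsilon_1)^2(1-\varepsilon_2^2)}{\mu(S)\mu(\Sigma)}\right)^{\frac{(a+s)(a+\beta)}{2a}}\|f\|_{1,\mu}^{a+s}\,\|f\|_{2,\mu}^{a+\beta}.$$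
   Context: Setting: $\Omega\subset\mathbb{R}^d$ is a convex cone ($\lambda x\in\Omega$ for all $\lambda>0$, $x\in\Omega$) with non-empty interior, endowed with a Borel measure $\mu$, absolutely continuous with respect to Lebesgue measure, with polar decomposition $d\mu(r\zeta)=r^{2a-1}\,dr\,Q(\zeta)\,d\omega(\zeta)$, where $a>0$, $d\omega$ is the surface measure on the unit sphere $\mathbb{S}^{d-1}$, and $Q\in L^1(\mathbb{S}^{d-1},d\omega)$, $Q\ne 0$ (so $\mu$ is homogeneous of degree $2a$). $\|\cdot\|_{p,\mu}$ is the norm of $L^p(\Omega,\mu)$ and $\langle f,g\rangle_\mu=\int_\Omega f\overline{g}\,d\mu$. The kernel $\mathcal{K}:\Omega\times\Omega\to\mathbb{C}$ is continuous, bounded ($|\mathcal{K}(x,\xi)|\le c_{\mathcal{K}}$) and homogeneous ($\mathcal{K}(\lambda x,\xi)=\mathcal{K}(x,\lambda\xi)$ for $\lambda>0$). The operator $\mathcal{T}$ is $\mathcal{T}f(\xi)=\int_\Omega f(x)\mathcal{K}(x,\xi)\,d\mu(x)$. It is assumed that (i) (inversion) if $f,\mathcal{T}f\in L^1(\Omega,\mu)$ then $f$ is continuous and $f(x)=\int_\Omega\mathcal{T}f(\xi)\overline{\mathcal{K}(x,\xi)}\,d\mu(\xi)$ for almost every $x$; (ii) (Parseval) $\langle\mathcal{T}f,\mathcal{T}g\rangle_\mu=\langle f,g\rangle_\mu$ for Schwartz functions $f,g$ on $\Omega$; in particular $\mathcal{T}$ extends to a unitary operator of $L^2(\Omega,\mu)$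 onto itself, with $\mathcal{T}^{-1}f=\overline{\mathcal{T}\overline{f}}$. Weighted norms may take the value $+\infty$. For measurable $A\subset\Omega$, $A^c=\Omega\setminus A$, $E_Af=\chi_Af$ and $F_Af=\mathcal{T}^{-1}[\chi_A\mathcal{T}f]$ (on $L^2(\Omega,\mu)$). A nonzero $f\in L^1(\Omega,\mu)$ is $\varepsilon$-timelimited on $S$ if $\|E_{S^c}f\|_{1,\mu}\le\varepsilon\|f\|_{1,\mu}$; a nonzero $f\in L^2(\Omega,\mu)$ is $\varepsilon$-bandlimited on $\Sigma$ if $\|F_{\Sigma^c}f\|_{2,\mu}\le\varepsilon\|f\|_{2,\mu}$. $L^1\cap L^2(\varepsilon_1,\varepsilon_2,S,\Sigma)$ is the set of $f\in L^1(\Omega,\mu)\cap L^2(\Omega,\mu)$ that are $\varepsilon_1$-timelimited on $S$ and $\varepsilon_2$-bandlimited on $\Sigma$. Constants $C$ depend only on the setting ($\Omega,\mu,\mathcal{K}$) and the parameters, not on $f$, $S$, $\Sigma$. *)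

theory Defs
  imports "HOL-Analysis.Analysis"
begin

subsection \<open>Extended norms\<close>

text \<open>Real powers on \<open>[0,\<infinity>]\<close>; the convention at infinity is the right one for \<open>p > 0\<close>,
  which is the only case that is used.\<close>

definition epowr :: "ennreal \<Rightarrow> real \<Rightarrow> ennreal" (infixr "epowr" 80) where
  "x epowr p = (if x = \<infinity> then \<infinity> else ennreal (enn2real x powr p))"

definition Lp_norm :: "real \<Rightarrow> 'a measure \<Rightarrow> ('a \<Rightarrow> complex) \<Rightarrow> ennreal" where
  "Lp_norm p M f = (\<integral>\<^sup>+ x. ennreal (norm (f x) powr p) \<partial>M) epowr (1 / p)"

text \<open>Genuine functions are used, not classes modulo null sets.\<close>

definition Lp_space :: "real \<Rightarrow> 'a measure \<Rightarrow> ('a \<Rightarrow> complex) set" where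
  "Lp_space p M = {f \<in> borel_measurable M. Lp_norm p M f < \<infinity>}"

definition L2_inner :: "'a measure \<Rightarrow> ('a \<Rightarrow> complex) \<Rightarrow> ('a \<Rightarrow> complex) \<Rightarrow> complex" where
  "L2_inner M f g = (\<integral> x. f x * cnj (g x) \<partial>M)"

definition ae_nonzero :: "'a measure \<Rightarrow> ('a \<Rightarrow> complex) \<Rightarrow> bool" where
  "ae_nonzero M f \<longleftrightarrow> \<not> (AE x in M. f x = 0)"


subsection \<open>Surface measure of the unit sphere\<close>

text \<open>The surface measure of \<open>A\<close> is \<open>d\<close> times the volume of the solid sector
  \<open>{r \<zeta> | 0 < r < 1, \<zeta> \<in> A}\<close>; note that \<open>sgn x = x / \<bar>x\<bar>\<close>. The completion is taken because
  a convex cone need not be a Borel set, but its trace on the sphere is measurable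
  up to a null set.\<close>

definition surface_measure :: "'a::euclidean_space measure" where
  "surface_measure = completion (scale_measure (of_nat DIM('a))
     (distr (restrict_space lborel (ball 0 1 - {0})) (restrict_space borel (sphere 0 1)) sgn))"

lemma emeasure_surface_measure:
  fixes A :: "'a::euclidean_space set"
  assumes "A \<in> sets borel" "A \<subseteq> sphere 0 1"
  shows "emeasure surface_measure A =
    of_nat DIM('a) * emeasure lborel {x \<in> ball 0 1 - {0}. sgn x \<in> A}"
proof -
  let ?B = "ball 0 1 - {0} :: 'a set"
  have "sgn \<in> borel_measurable (borel :: 'a measure)"
    unfolding sgn_div_norm[abs_def] by measurable
  then have "sgn \<in> borel_measurable (restrict_space lborel ?B)"
    by (intro measurable_restrict_space1) simp
  moreover have "sgn x \<in> sphere 0 1" if "x \<in> ?B" for x :: 'a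
    using that by (simp add: norm_sgn)
  ultimately have m: "sgn \<in> measurable (restrict_space lborel ?B) (restrict_space borel (sphere 0 1))"
    by (auto simp: measurable_restrict_space2_iff space_restrict_space)
  have A: "A \<in> sets (restrict_space borel (sphere 0 1))"
    using assms by (auto simp: sets_restrict_space_iff)
  have "emeasure surface_measure A = of_nat DIM('a) *
      emeasure (restrict_space lborel ?B) (sgn -` A \<inter> space (restrict_space lborel ?B))"
    unfolding surface_measure_def using A m
    by (simp add: emeasure_distr)
  also have "sgn -` A \<inter> space (restrict_space lborel ?B) = {x \<in> ?B. sgn x \<in> A}"
    by (auto simp: space_restrict_space)
  also have "emeasure (restrict_space lborel ?B) {x \<in> ?B. sgn x \<in> A} =
      emeasure lborel {x \<in> ?B. sgn x \<in> A}"
    by (rule emeasure_restrict_space) auto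
  finally show ?thesis .
qed


subsection \<open>Schwartz functions\<close>

primrec iterated_pderiv :: "'a list \<Rightarrow> ('a::euclidean_space \<Rightarrow> complex) \<Rightarrow> 'a \<Rightarrow> complex" where
  "iterated_pderiv [] f = f"
| "iterated_pderiv (b # bs) f = (\<lambda>x. frechet_derivative (iterated_pderiv bs f) (at x) b)"

definition schwartz :: "('a::euclidean_space \<Rightarrow> complex) \<Rightarrow> bool" where
  "schwartz f \<longleftrightarrow> (\<forall>bs. set bs \<subseteq> Basis \<longrightarrow>
     (\<forall>x. iterated_pderiv bs f differentiable (at x)) \<and>
     (\<forall>n::nat. bounded (range (\<lambda>x. norm x ^ n *\<^sub>R iterated_pderiv bs f x))))"

definition schwartz_on :: "'a::euclidean_space set \<Rightarrow> ('a \<Rightarrow> complex) \<Rightarrow> bool" where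
  "schwartz_on \<Omega> f \<longleftrightarrow> (\<exists>g. schwartz g \<and> (\<forall>x\<in>\<Omega>. f x = g x))"


subsection \<open>The integral operator\<close>

definition int_op :: "'a measure \<Rightarrow> ('a \<Rightarrow> 'a \<Rightarrow> complex) \<Rightarrow> ('a \<Rightarrow> complex) \<Rightarrow> 'a \<Rightarrow> complex" where
  "int_op \<mu> K f \<xi> = (\<integral> x. f x * K x \<xi> \<partial>\<mu>)"

text \<open>A unitary operator of \<open>L\<^sup>2\<close> onto itself, acting on representatives.\<close>

definition L2_unitary :: "'a measure \<Rightarrow> (('a \<Rightarrow> complex) \<Rightarrow> 'a \<Rightarrow> complex) \<Rightarrow> bool" where
  "L2_unitary \<mu> U \<longleftrightarrow>
     (\<forall>f\<in>Lp_space 2 \<mu>. U f \<in> Lp_space 2 \<mu>) \<and>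
     (\<forall>f\<in>Lp_space 2 \<mu>. \<forall>g\<in>Lp_space 2 \<mu>. \<forall>\<alpha> \<beta>.
        AE x in \<mu>. U (\<lambda>y. \<alpha> * f y + \<beta> * g y) x = \<alpha> * U f x + \<beta> * U g x) \<and>
     (\<forall>f\<in>Lp_space 2 \<mu>. \<forall>g\<in>Lp_space 2 \<mu>. L2_inner \<mu> (U f) (U g) = L2_inner \<mu> f g) \<and>
     (\<forall>g\<in>Lp_space 2 \<mu>. \<exists>f\<in>Lp_space 2 \<mu>. AE x in \<mu>. U f x = g x)"

text \<open>The inverse is determined up to a null set.\<close>

definition L2_inv ::
  "'a measure \<Rightarrow> (('a \<Rightarrow> complex) \<Rightarrow> 'a \<Rightarrow> complex) \<Rightarrow> ('a \<Rightarrow> complex) \<Rightarrow> 'a \<Rightarrow> complex" where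
  "L2_inv \<mu> U g = (SOME f. f \<in> Lp_space 2 \<mu> \<and> (AE x in \<mu>. U f x = g x))"

text \<open>The parameter \<open>T2\<close> is the unitary extension to \<open>L\<^sup>2\<close> of the integral operator on Schwartz
  functions; by density it is unique up to null sets.
  The measure \<open>\<mu>\<close> lives on \<open>\<Omega>\<close>, i.e. \<open>space \<mu> = \<Omega>\<close>. As \<open>L\<^sup>1\<close> functions are representatives here,
  continuity in the inversion hypothesis means equality almost everywhere with a
  continuous function.\<close>

locale cone_transform =
  fixes \<Omega> :: "'a::euclidean_space set"
    and a :: real
    and Q :: "'a \<Rightarrow> real"
    and \<mu> :: "'a measure"
    and K :: "'a \<Rightarrow> 'a \<Rightarrow> complex"
    and T2 :: "('a \<Rightarrow> complex) \<Rightarrow> 'a \<Rightarrow> complex"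
  assumes convex_cone: "convex \<Omega>" "\<And>l x. 0 < l \<Longrightarrow> x \<in> \<Omega> \<Longrightarrow> l *\<^sub>R x \<in> \<Omega>" "interior \<Omega> \<noteq> {}"
    and a_pos: "0 < a"
    and Q_L1: "integrable surface_measure Q"
    and Q_nonneg: "AE \<zeta> in surface_measure. 0 \<le> Q \<zeta>"
    and Q_nonzero: "\<not> (AE \<zeta> in surface_measure. Q \<zeta> = 0)"
    and sets_mu: "sets \<mu> = sets (restrict_space borel \<Omega>)"
    and abs_cont: "\<And>A. A \<in> sets \<mu> \<Longrightarrow> A \<in> null_sets lebesgue \<Longrightarrow> A \<in> null_sets \<mu>"
    and polar: "\<And>A. A \<in> sets \<mu> \<Longrightarrow> emeasure \<mu> A =
      (\<integral>\<^sup>+ \<zeta>. (\<integral>\<^sup>+ r\<in>{0<..}. indicator A (r *\<^sub>R \<zeta>) * ennreal (r powr (2 * a - 1)) \<partial>lborel)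
        * ennreal (Q \<zeta>) \<partial>surface_measure)"
    and K_continuous: "continuous_on (\<Omega> \<times> \<Omega>) (\<lambda>(x, \<xi>). K x \<xi>)"
    and K_bounded: "\<exists>c. \<forall>x\<in>\<Omega>. \<forall>\<xi>\<in>\<Omega>. norm (K x \<xi>) \<le> c"
    and K_homogeneous:
      "\<And>l x \<xi>. 0 < l \<Longrightarrow> x \<in> \<Omega> \<Longrightarrow> \<xi> \<in> \<Omega> \<Longrightarrow> K (l *\<^sub>R x) \<xi> = K x (l *\<^sub>R \<xi>)"
    and inversion: "\<And>f. f \<in> Lp_space 1 \<mu> \<Longrightarrow> int_op \<mu> K f \<in> Lp_space 1 \<mu> \<Longrightarrow>
      (\<exists>g. continuous_on \<Omega> g \<and> (AE x in \<mu>. f x = g x)) \<and>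
      (AE x in \<mu>. f x = (\<integral> \<xi>. int_op \<mu> K f \<xi> * cnj (K x \<xi>) \<partial>\<mu>))"
    and parseval: "\<And>f g. schwartz_on \<Omega> f \<Longrightarrow> schwartz_on \<Omega> g \<Longrightarrow>
      L2_inner \<mu> (int_op \<mu> K f) (int_op \<mu> K g) = L2_inner \<mu> f g"
    and T2_extends: "\<And>f. schwartz_on \<Omega> f \<Longrightarrow> AE \<xi> in \<mu>. T2 f \<xi> = int_op \<mu> K f \<xi>"
    and T2_unitary: "L2_unitary \<mu> T2"
    and T2_inverse: "\<And>f. f \<in> Lp_space 2 \<mu> \<Longrightarrow>
      AE x in \<mu>. L2_inv \<mu> T2 f x = cnj (T2 (\<lambda>y. cnj (f y)) x)"


subsection \<open>Time and band limiting\<close>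

definition time_proj :: "'a set \<Rightarrow> ('a \<Rightarrow> complex) \<Rightarrow> 'a \<Rightarrow> complex" where
  "time_proj A f = (\<lambda>x. indicator A x * f x)"

definition band_proj ::
  "'a measure \<Rightarrow> (('a \<Rightarrow> complex) \<Rightarrow> 'a \<Rightarrow> complex) \<Rightarrow> 'a set \<Rightarrow> ('a \<Rightarrow> complex) \<Rightarrow> 'a \<Rightarrow> complex" where
  "band_proj \<mu> T2 A f = L2_inv \<mu> T2 (\<lambda>\<xi>. indicator A \<xi> * T2 f \<xi>)"

definition timelimited :: "'a measure \<Rightarrow> real \<Rightarrow> 'a set \<Rightarrow> ('a \<Rightarrow> complex) \<Rightarrow> bool" where
  "timelimited \<mu> \<epsilon> S f \<longleftrightarrow> f \<in> Lp_space 1 \<mu> \<and> ae_nonzero \<mu> f \<and>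
     Lp_norm 1 \<mu> (time_proj (space \<mu> - S) f) \<le> ennreal \<epsilon> * Lp_norm 1 \<mu> f"

definition bandlimited ::
  "'a measure \<Rightarrow> (('a \<Rightarrow> complex) \<Rightarrow> 'a \<Rightarrow> complex) \<Rightarrow> real \<Rightarrow> 'a set \<Rightarrow> ('a \<Rightarrow> complex) \<Rightarrow> bool" where
  "bandlimited \<mu> T2 \<epsilon> \<Sigma> f \<longleftrightarrow> f \<in> Lp_space 2 \<mu> \<and> ae_nonzero \<mu> f \<and>
     Lp_norm 2 \<mu> (band_proj \<mu> T2 (space \<mu> - \<Sigma>) f) \<le> ennreal \<epsilon> * Lp_norm 2 \<mu> f"

definition L1_L2_limited ::
  "'a measure \<Rightarrow> (('a \<Rightarrow> complex) \<Rightarrow> 'a \<Rightarrow> complex) \<Rightarrow> real \<Rightarrow> real \<Rightarrow> 'a set \<Rightarrow> 'a set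
    \<Rightarrow> ('a \<Rightarrow> complex) set" where
  "L1_L2_limited \<mu> T2 \<epsilon>1 \<epsilon>2 S \<Sigma> = {f \<in> Lp_space 1 \<mu> \<inter> Lp_space 2 \<mu>.
     timelimited \<mu> \<epsilon>1 S f \<and> bandlimited \<mu> T2 \<epsilon>2 \<Sigma> f}"

definition weighted :: "real \<Rightarrow> ('a::real_normed_vector \<Rightarrow> complex) \<Rightarrow> 'a \<Rightarrow> complex" where
  "weighted s f = (\<lambda>x. of_real (norm x powr s) * f x)"

end

theory Submission
  imports Defs "HOL-Real_Asymp.Real_Asymp"
begin

text \<open>With \<open>B\<close> the ball of radius \<open>R\<close>, homogeneity gives \<open>\<mu>(B) \<le> \<kappa> R\<^sup>2\<^sup>a\<close>. Splitting
  the \<open>L\<^sup>2\<close> norm of the transform \<open>h\<close> of \<open>f\<close> at \<open>B\<close>, with \<open>\<bar>h\<bar> \<le> c \<parallel>f\<parallel>\<^sub>1\<close> inside and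
  \<open>\<bar>h\<bar> \<le> R\<^sup>-\<^sup>\<beta> \<bar>\<xi>\<bar>\<^sup>\<beta> \<bar>h\<bar>\<close> outside, bounds \<open>\<parallel>f\<parallel>\<^sub>2\<close>; splitting the \<open>L\<^sup>1\<close> norm of \<open>f\<close> with the
  Cauchy-Schwarz inequality inside bounds \<open>\<parallel>f\<parallel>\<^sub>1\<close>. Time limitation gives
  \<open>(1 - \<epsilon>\<^sub>1) \<parallel>f\<parallel>\<^sub>1 \<le> \<mu>(S)\<^sup>1\<^sup>/\<^sup>2 \<parallel>f\<parallel>\<^sub>2\<close> and band limitation
  \<open>(1 - \<epsilon>\<^sub>2\<^sup>2)\<^sup>1\<^sup>/\<^sup>2 \<parallel>f\<parallel>\<^sub>2 \<le> c \<mu>(\<Sigma>)\<^sup>1\<^sup>/\<^sup>2 \<parallel>f\<parallel>\<^sub>1\<close>; for a suitable \<open>R\<close> the inner part is absorbed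
  in the left-hand side. The third inequality is the product of powers of the first two.

  The bound on \<open>h\<close> comes from the integral operator, while its norm is that of the unitary
  extension, which is tied to the integral operator on Schwartz functions only. They agree on
  all of \<open>L\<^sup>1 \<inter> L\<^sup>2\<close> by approximation: Gaussians times products of logistic functions are
  Schwartz functions, and they tend, dominated by the Gaussian, to Gaussians restricted to
  boxes.\<close>

subsection \<open>Schwartz functions approximating indicators of boxes\<close>

definition logistic :: "real \<Rightarrow> real" where
  "logistic t = 1 / (1 + exp (- t))"

lemma logistic_bounds: "0 \<le> logistic t" "logistic t \<le> 1"
  by (simp_all add: logistic_def add_pos_nonneg)

text \<open>The derivative is a polynomial in the function itself, so differentiation does not lead
  out of the algebra \<open>tame\<close>.\<close>

lemma DERIV_logistic: "(logistic has_real_derivative logistic t * (1 - logistic t)) (at t)"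
proof -
  have "1 + exp (- t) \<noteq> 0" using exp_gt_zero[of "- t"] by linarith
  then show ?thesis
    unfolding logistic_def[abs_def]
    by (auto intro!: derivative_eq_intros simp: field_simps power2_eq_square)
qed

text \<open>The algebra generated by linear forms and logistic functions of affine forms. It is
  closed under directional derivatives and grows at most polynomially, which makes its products with
  a Gaussian Schwartz functions; products of logistic functions in it approximate boxes.\<close>

inductive tame :: "('a::euclidean_space \<Rightarrow> real) \<Rightarrow> bool" where
  const: "tame (\<lambda>x. c)"
| inner: "tame (\<lambda>x. x \<bullet> b)"
| logistic: "tame (\<lambda>x. logistic (x \<bullet> b + q))"
| add: "tame f \<Longrightarrow> tame g \<Longrightarrow> tame (\<lambda>x. f x + g x)"
| mult: "tame f \<Longrightarrow> tame g \<Longrightarrow> tame (\<lambda>x. f x * g x)"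

lemma tame_diff: "tame f \<Longrightarrow> tame g \<Longrightarrow> tame (\<lambda>x. f x - g x)"
  using tame.add[of f, OF _ tame.mult[OF tame.const[of "-1"], of g]] by simp

lemma tame_prod: "(\<And>i. i \<in> I \<Longrightarrow> tame (f i)) \<Longrightarrow> tame (\<lambda>x. \<Prod>i\<in>I. f i x)"
  by (induction I rule: infinite_finite_induct) (auto intro: tame.intros)

text \<open>Structural induction by the usual differentiation rules. The direction \<open>v\<close>
  is fixed while the point moves, so factors such as \<open>v \<bullet> b\<close> count as
  constants.\<close>

lemma tame_has_derivative:
  "tame h \<Longrightarrow> \<exists>h'. (\<forall>x. (h has_derivative h' x) (at x)) \<and> (\<forall>v. tame (\<lambda>x. h' x v))"
proof (induction rule: tame.induct)
  case (const c)
  then show ?case by (intro exI[of _ "\<lambda>_ _. 0"]) (auto intro: tame.const)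
next
  case (inner b)
  then show ?case
    by (intro exI[of _ "\<lambda>_ v. v \<bullet> b"]) (auto intro!: tame.const derivative_eq_intros)
next
  case (logistic b q)
  have "((\<lambda>x. logistic (x \<bullet> b + q)) has_derivative
      (\<lambda>v. (v \<bullet> b) * (logistic (x \<bullet> b + q) * (1 - logistic (x \<bullet> b + q))))) (at x)" for x
    by (rule derivative_eq_intros DERIV_compose_FDERIV[OF DERIV_logistic] refl)+
       (simp add: fun_eq_iff)
  then show ?case
    by (intro exI[of _ "\<lambda>x v. (v \<bullet> b) * (logistic (x \<bullet> b + q) * (1 - logistic (x \<bullet> b + q)))"])
       (intro conjI allI tame.const tame.mult tame_diff tame.logistic, assumption)
next
  case (add f g)
  then obtain f' g' where "\<And>x. (f has_derivative f' x) (at x)" "\<And>v. tame (\<lambda>x. f' x v)"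
    "\<And>x. (g has_derivative g' x) (at x)" "\<And>v. tame (\<lambda>x. g' x v)" by metis
  then show ?case
    by (intro exI[of _ "\<lambda>x v. f' x v + g' x v"])
       (auto intro!: tame.intros derivative_eq_intros)
next
  case (mult f g)
  then obtain f' g' where "\<And>x. (f has_derivative f' x) (at x)" "\<And>v. tame (\<lambda>x. f' x v)"
    "\<And>x. (g has_derivative g' x) (at x)" "\<And>v. tame (\<lambda>x. g' x v)" by metis
  with mult.hyps show ?case
    by (intro exI[of _ "\<lambda>x v. f x * g' x v + f' x v * g x"])
       (auto intro!: tame.intros derivative_eq_intros)
qed

lemma tame_growth: "tame h \<Longrightarrow> \<exists>C k. 0 \<le> C \<and> (\<forall>x. \<bar>h x\<bar> \<le> C * (1 + norm x) ^ k)"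
proof (induction rule: tame.induct)
  case (const c)
  then show ?case by (intro exI[of _ "\<bar>c\<bar>"] exI[of _ 0]) auto
next
  case (inner b)
  have "\<bar>x \<bullet> b\<bar> \<le> norm b * (1 + norm x)" for x
    using Cauchy_Schwarz_ineq2[of x b] norm_ge_zero[of b] by (simp add: algebra_simps del: norm_ge_zero)
  then show ?case by (intro exI[of _ "norm b"] exI[of _ 1]) auto
next
  case (logistic b q)
  then show ?case using logistic_bounds by (intro exI[of _ 1] exI[of _ 0]) auto
next
  case (add f g)
  then obtain C k D l where *: "0 \<le> C" "\<And>x. \<bar>f x\<bar> \<le> C * (1 + norm x) ^ k"
    "0 \<le> D" "\<And>x. \<bar>g x\<bar> \<le> D * (1 + norm x) ^ l" by metis
  \<comment> \<open>The sum of the exponents serves as a common bound for both, the base being at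
    least 1.\<close>
  have "\<bar>f x + g x\<bar> \<le> (C + D) * (1 + norm x) ^ (k + l)" for x
  proof -
    have "C * (1 + norm x) ^ k \<le> C * (1 + norm x) ^ (k + l)"
      "D * (1 + norm x) ^ l \<le> D * (1 + norm x) ^ (k + l)"
      using * by (auto intro!: mult_left_mono power_increasing)
    with *(2,4)[of x] show ?thesis by (simp add: algebra_simps)
  qed
  with * show ?case by (intro exI[of _ "C + D"] exI[of _ "k + l"]) auto
next
  case (mult f g)
  then obtain C k D l where *: "0 \<le> C" "\<And>x. \<bar>f x\<bar> \<le> C * (1 + norm x) ^ k"
    "0 \<le> D" "\<And>x. \<bar>g x\<bar> \<le> D * (1 + norm x) ^ l" by metis
  have "\<bar>f x * g x\<bar> \<le> (C * D) * (1 + norm x) ^ (k + l)" for x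
  proof -
    have "\<bar>f x\<bar> * \<bar>g x\<bar> \<le> (C * (1 + norm x) ^ k) * (D * (1 + norm x) ^ l)"
      using * by (intro mult_mono) auto
    then show ?thesis by (simp add: abs_mult power_add mult_ac)
  qed
  with * show ?case by (intro exI[of _ "C * D"] exI[of _ "k + l"]) auto
qed

section \<open>Gaussians times tame functions are Schwartz\<close>

definition gauss :: "'a::real_inner \<Rightarrow> real" where
  "gauss x = exp (- (x \<bullet> x))"

lemma gauss_pos: "0 < gauss x" and gauss_le_1: "gauss x \<le> 1"
  by (simp_all add: gauss_def)

lemma gauss_measurable [measurable]: "(gauss :: 'a::euclidean_space \<Rightarrow> real) \<in> borel_measurable borel"
  unfolding gauss_def[abs_def] by measurable

text \<open>With t = 1 + r and r the norm of x, the chain (t/m)^m \<le> (1 + t/m)^m \<le> exp t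
  gives t^m \<le> m^m exp t, and 1 + r - r^2 \<le> 2 because (r - 1/2)^2 is nonnegative. The case m
  = 0 is separate because of the division by m.\<close>

lemma power_times_gauss_bounded:
  obtains B where "\<And>x::'a::real_inner. (1 + norm x) ^ m * gauss x \<le> B"
proof (cases "m = 0")
  case True
  then show ?thesis using that[of 1] gauss_le_1 by auto
next
  case False
  have "(1 + norm x) ^ m * gauss x \<le> real m ^ m * exp 2" for x :: 'a
  proof -
    have "((1 + norm x) / m) ^ m \<le> (1 + (1 + norm x) / m) ^ m"
      by (intro power_mono) auto
    also have "\<dots> \<le> exp (1 + norm x)"
      using False by (intro exp_ge_one_plus_x_over_n_power_n) (auto intro: order_trans[of _ 0])
    finally have "(1 + norm x) ^ m \<le> real m ^ m * exp (1 + norm x)"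
      using False by (simp add: power_divide field_simps)
    then have "(1 + norm x) ^ m * gauss x \<le> real m ^ m * exp (1 + norm x) * gauss x"
      by (rule mult_right_mono) (simp add: gauss_def)
    also have "\<dots> = real m ^ m * exp (1 + norm x - (norm x)\<^sup>2)"
      by (simp add: gauss_def exp_diff exp_minus power2_norm_eq_inner field_simps)
    also have "\<dots> \<le> real m ^ m * exp 2"
    proof -
      have "1 + norm x - (norm x)\<^sup>2 \<le> 2"
        using zero_le_power2[of "norm x - 1/2"] by (simp add: power2_eq_square algebra_simps)
      then show ?thesis by (intro mult_left_mono) auto
    qed
    finally show ?thesis .
  qed
  then show ?thesis by (rule that)
qed

lemma gauss_times_tame_has_derivative:
  fixes h :: "'a::euclidean_space \<Rightarrow> real"
  assumes h: "(h has_derivative h') (at x)"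
  shows "((\<lambda>x. complex_of_real (gauss x * h x)) has_derivative
     (\<lambda>v. complex_of_real (gauss x * (h' v - 2 * (x \<bullet> v) * h x)))) (at x)"
proof -
  have "((\<lambda>x. gauss x * h x) has_derivative
     (\<lambda>v. gauss x * (h' v - 2 * (x \<bullet> v) * h x))) (at x)"
    unfolding gauss_def
    by (rule derivative_eq_intros h refl)+
       (simp add: fun_eq_iff algebra_simps inner_commute)
  then show ?thesis by (rule has_derivative_of_real)
qed

text \<open>The derivative of \<open>gauss x * k x\<close> in direction \<open>b\<close> is the
  Gaussian times \<open>k' x b - 2 * (x \<bullet> b) * k x\<close>, whose second factor is again
  tame.\<close>

lemma iterated_pderiv_gauss_tame:
  fixes h :: "'a::euclidean_space \<Rightarrow> real"
  assumes "tame h"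
  shows "\<exists>k. tame k \<and> iterated_pderiv bs (\<lambda>x. complex_of_real (gauss x * h x)) =
    (\<lambda>x. complex_of_real (gauss x * k x))"
proof (induction bs)
  case Nil
  with assms show ?case by auto
next
  case (Cons b bs)
  then obtain k where k: "tame k" and eq: "iterated_pderiv bs (\<lambda>x. complex_of_real (gauss x * h x)) =
    (\<lambda>x. complex_of_real (gauss x * k x))" by auto
  from tame_has_derivative[OF k] obtain k' where
    k': "\<And>x. (k has_derivative k' x) (at x)" "\<And>v. tame (\<lambda>x. k' x v)" by auto
  let ?k = "\<lambda>x. k' x b - 2 * (x \<bullet> b) * k x"
  have "tame ?k" by (intro tame_diff tame.mult tame.const tame.inner k k')
  moreover have "iterated_pderiv (b # bs) (\<lambda>x. complex_of_real (gauss x * h x)) =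
    (\<lambda>x. complex_of_real (gauss x * ?k x))"
    unfolding iterated_pderiv.simps eq
    using frechet_derivative_at[OF gauss_times_tame_has_derivative[OF k'(1)]]
    by (auto simp: fun_eq_iff dest: fun_cong)
  ultimately show ?case by blast
qed

text \<open>Every iterated derivative is a Gaussian times a tame function, hence differentiable, and
  the Gaussian absorbs the growth of the tame factor together with the weight
  \<open>norm x ^ n\<close>.\<close>

lemma schwartz_gauss_tame:
  fixes h :: "'a::euclidean_space \<Rightarrow> real"
  assumes "tame h"
  shows "schwartz (\<lambda>x. complex_of_real (gauss x * h x))"
  unfolding schwartz_def
proof (intro allI impI conjI)
  fix bs :: "'a list" and x :: 'a and n :: nat
  obtain k where k: "tame k" and eq: "iterated_pderiv bs (\<lambda>x. complex_of_real (gauss x * h x)) =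
    (\<lambda>x. complex_of_real (gauss x * k x))"
    using iterated_pderiv_gauss_tame[OF assms] by blast
  from tame_has_derivative[OF k] obtain k' where
    k': "\<And>x. (k has_derivative k' x) (at x)" by auto
  show "iterated_pderiv bs (\<lambda>x. complex_of_real (gauss x * h x)) differentiable (at x)"
    unfolding eq using gauss_times_tame_has_derivative[OF k'] by (auto simp: differentiable_def)
  obtain C m where C: "0 \<le> C" "\<And>x. \<bar>k x\<bar> \<le> C * (1 + norm x) ^ m"
    using tame_growth[OF k] by auto
  obtain B where B: "\<And>x::'a. (1 + norm x) ^ (n + m) * gauss x \<le> B"
    using power_times_gauss_bounded[of "n + m"] by blast
  have "norm (norm x ^ n *\<^sub>R complex_of_real (gauss x * k x)) \<le> C * B" for x :: 'a
  proof -
    have "norm (norm x ^ n *\<^sub>R complex_of_real (gauss x * k x)) = norm x ^ n * gauss x * \<bar>k x\<bar>"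
      by (simp add: abs_mult less_imp_le[OF gauss_pos] del: of_real_mult)
    also have "\<dots> \<le> (1 + norm x) ^ n * gauss x * (C * (1 + norm x) ^ m)"
      using C less_imp_le[OF gauss_pos[of x]] by (intro mult_mono power_mono) auto
    also have "\<dots> = C * ((1 + norm x) ^ (n + m) * gauss x)"
      by (simp add: power_add mult_ac)
    also have "\<dots> \<le> C * B" using B C(1) by (rule mult_left_mono)
    finally show ?thesis .
  qed
  then show "bounded (range (\<lambda>x. norm x ^ n *\<^sub>R
      iterated_pderiv bs (\<lambda>x. complex_of_real (gauss x * h x)) x))"
    unfolding eq bounded_iff by blast
qed

text \<open>The shift by \<open>sqrt n\<close> makes the limit vanish at \<open>d = 0\<close>.\<close>

lemma logistic_tendsto_indicator:
  "(\<lambda>n. logistic (real n * d - sqrt (real n))) \<longlonglongrightarrow> (if 0 < d then 1 else 0)"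
proof -
  consider "0 < d" | "d = 0" | "d < 0" by linarith
  then show ?thesis
    unfolding logistic_def by cases (simp_all; real_asymp)+
qed

text \<open>In each coordinate one factor switches on at the lower face and the other switches off
  at the upper face. The limit is the indicator of the open box at every point, boundary
  included.\<close>

definition box_approx :: "'a::euclidean_space \<Rightarrow> 'a \<Rightarrow> nat \<Rightarrow> 'a \<Rightarrow> real" where
  "box_approx l u n x = (\<Prod>i\<in>Basis. logistic (real n * (x \<bullet> i - l \<bullet> i) - sqrt (real n)) *
     logistic (real n * (u \<bullet> i - x \<bullet> i) - sqrt (real n)))"

lemma box_approx_bounds: "0 \<le> box_approx l u n x" "box_approx l u n x \<le> 1"
  unfolding box_approx_def
  by (auto intro!: prod_nonneg prod_le_1 mult_le_one simp: logistic_bounds)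

lemma tame_box_approx: "tame (box_approx l u n)"
proof -
  have "tame (\<lambda>x. logistic (real n * (x \<bullet> i - l \<bullet> i) - sqrt (real n)))" for i
    using tame.logistic[of "real n *\<^sub>R i" "- real n * (l \<bullet> i) - sqrt (real n)"]
    by (simp add: algebra_simps)
  moreover have "tame (\<lambda>x. logistic (real n * (u \<bullet> i - x \<bullet> i) - sqrt (real n)))" for i
    using tame.logistic[of "- real n *\<^sub>R i" "real n * (u \<bullet> i) - sqrt (real n)"]
    by (simp add: algebra_simps)
  ultimately show ?thesis
    unfolding box_approx_def[abs_def] by (intro tame_prod tame.mult)
qed

lemma box_approx_tendsto: "(\<lambda>n. box_approx l u n x) \<longlonglongrightarrow> indicator (box l u) x"
proof -
  have "(\<lambda>n. box_approx l u n x) \<longlonglongrightarrow>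
    (\<Prod>i\<in>Basis. (if 0 < x \<bullet> i - l \<bullet> i then 1 else 0) * (if 0 < u \<bullet> i - x \<bullet> i then 1 else 0))"
    unfolding box_approx_def by (intro tendsto_intros logistic_tendsto_indicator)
  also have "(\<Prod>i\<in>Basis. (if 0 < x \<bullet> i - l \<bullet> i then 1 else 0) * (if 0 < u \<bullet> i - x \<bullet> i then 1 else 0))
    = (indicator (box l u) x :: real)"
  proof (cases "x \<in> box l u")
    case True
    then show ?thesis by (auto simp: mem_box intro!: prod.neutral)
  next
    case False
    then show ?thesis by (auto simp: mem_box intro!: prod_zero)
  qed
  finally show ?thesis .
qed

subsection \<open>Norms\<close>

lemma epowr_top [simp]: "top epowr p = top"
  by (simp add: epowr_def)

lemma epowr_ennreal: "0 \<le> x \<Longrightarrow> ennreal x epowr p = ennreal (x powr p)"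
  by (simp add: epowr_def)

lemma epowr_one [simp]: "x epowr 1 = x"
  by (cases x) (auto simp: epowr_def)

text \<open>Squaring removes the exponent 1/2; most L2 estimates below are carried out on squared
  norms for this reason.\<close>

lemma epowr_half_power2: "(x epowr (1 / 2))\<^sup>2 = x"
proof (cases x)
  case (real r)
  then show ?thesis
    by (simp add: epowr_ennreal ennreal_power powr_half_sqrt)
qed (simp add: power2_eq_square)

lemma Lp_norm_1: "Lp_norm 1 M f = (\<integral>\<^sup>+ x. norm (f x) \<partial>M)"
  by (simp add: Lp_norm_def)

lemma Lp_norm_2_power2: "(Lp_norm 2 M f)\<^sup>2 = (\<integral>\<^sup>+ x. (norm (f x))\<^sup>2 \<partial>M)"
  by (simp add: Lp_norm_def epowr_half_power2)

lemma Lp_space_1_iff: "f \<in> Lp_space 1 M \<longleftrightarrow> integrable M f"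
  by (auto simp: Lp_space_def Lp_norm_1 integrable_iff_bounded)

lemma Lp_space_2_iff:
  "f \<in> Lp_space 2 M \<longleftrightarrow> f \<in> borel_measurable M \<and> integrable M (\<lambda>x. (norm (f x))\<^sup>2)"
proof -
  have "Lp_norm 2 M f < \<infinity> \<longleftrightarrow> (Lp_norm 2 M f)\<^sup>2 < \<infinity>"
    by (auto simp: power_less_top_ennreal)
  then show ?thesis
    by (auto simp: Lp_space_def Lp_norm_2_power2 integrable_iff_bounded)
qed

lemma Lp_space_2_add:
  assumes "f \<in> Lp_space 2 M" "g \<in> Lp_space 2 M"
  shows "(\<lambda>x. \<alpha> * f x + \<beta> * g x) \<in> Lp_space 2 M"
proof -
  have [measurable]: "f \<in> borel_measurable M" "g \<in> borel_measurable M"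
    using assms by (auto simp: Lp_space_2_iff)
  have "integrable M (\<lambda>x. 2 * (norm \<alpha>)\<^sup>2 * (norm (f x))\<^sup>2 + 2 * (norm \<beta>)\<^sup>2 * (norm (g x))\<^sup>2)"
    using assms by (auto simp: Lp_space_2_iff)
  then have "integrable M (\<lambda>x. (norm (\<alpha> * f x + \<beta> * g x))\<^sup>2)"
  proof (rule Bochner_Integration.integrable_bound)
    have "(norm (\<alpha> * f x + \<beta> * g x))\<^sup>2
      \<le> 2 * (norm \<alpha>)\<^sup>2 * (norm (f x))\<^sup>2 + 2 * (norm \<beta>)\<^sup>2 * (norm (g x))\<^sup>2" for x
  proof -
    have "(norm (\<alpha> * f x + \<beta> * g x))\<^sup>2 \<le> (norm \<alpha> * norm (f x) + norm \<beta> * norm (g x))\<^sup>2"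
      using norm_triangle_ineq[of "\<alpha> * f x" "\<beta> * g x"] by (intro power_mono) (auto simp: norm_mult)
    \<comment> \<open>This is 2xy \<le> x^2 + y^2.\<close>
    also have "\<dots> \<le> 2 * (norm \<alpha> * norm (f x))\<^sup>2 + 2 * (norm \<beta> * norm (g x))\<^sup>2"
      using zero_le_power2[of "norm \<alpha> * norm (f x) - norm \<beta> * norm (g x)"]
      by (simp add: power2_eq_square algebra_simps)
    finally show ?thesis by (simp add: power_mult_distrib)
  qed
  then show "AE x in M. norm ((norm (\<alpha> * f x + \<beta> * g x))\<^sup>2)
      \<le> norm (2 * (norm \<alpha>)\<^sup>2 * (norm (f x))\<^sup>2 + 2 * (norm \<beta>)\<^sup>2 * (norm (g x))\<^sup>2)"
    by (intro AE_I2) simp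
  qed measurable
  then show ?thesis by (simp add: Lp_space_2_iff)
qed

lemma Lp_space_12_bound:
  fixes f :: "'a \<Rightarrow> complex" and g :: "'a \<Rightarrow> real"
  assumes "f \<in> borel_measurable M" "integrable M g" "integrable M (\<lambda>x. (g x)\<^sup>2)"
    and "\<And>x. x \<in> space M \<Longrightarrow> norm (f x) \<le> g x"
  shows "f \<in> Lp_space 1 M \<inter> Lp_space 2 M"
proof -
  have "integrable M f"
    using assms(2,1) by (rule Bochner_Integration.integrable_bound) (use assms(4) in \<open>auto intro: order_trans[OF _ abs_ge_self]\<close>)
  moreover have "integrable M (\<lambda>x. (norm (f x))\<^sup>2)"
    using assms(3) by (rule Bochner_Integration.integrable_bound) (use assms(1,4) in \<open>auto intro!: power_mono\<close>)
  ultimately show ?thesis using assms(1) by (simp add: Lp_space_1_iff Lp_space_2_iff)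
qed

section \<open>Isometries of L2 acting on representatives\<close>

lemma L2_inner_self:
  "L2_inner M f f = of_real (\<integral> x. (norm (f x))\<^sup>2 \<partial>M)"
  unfolding L2_inner_def by (simp add: complex_norm_square[symmetric] del: of_real_power)

lemma L2_unitary_isometry:
  assumes "L2_unitary M U" "f \<in> Lp_space 2 M"
  shows "(\<integral> x. (norm (U f x))\<^sup>2 \<partial>M) = (\<integral> x. (norm (f x))\<^sup>2 \<partial>M)"
  using assms L2_inner_self[of M f] L2_inner_self[of M "U f"] by (auto simp: L2_unitary_def)

lemma L2_unitary_isometry_nn:
  assumes "L2_unitary M U" "f \<in> Lp_space 2 M"
  shows "(\<integral>\<^sup>+ x. (norm (U f x))\<^sup>2 \<partial>M) = (\<integral>\<^sup>+ x. (norm (f x))\<^sup>2 \<partial>M)"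
proof -
  have "U f \<in> Lp_space 2 M" using assms by (auto simp: L2_unitary_def)
  with assms L2_unitary_isometry[OF assms] show ?thesis
    by (simp add: Lp_space_2_iff nn_integral_eq_integral)
qed

lemma L2_unitary_linear:
  assumes "L2_unitary M U" "f \<in> Lp_space 2 M" "g \<in> Lp_space 2 M"
  shows "AE x in M. U (\<lambda>y. \<alpha> * f y + \<beta> * g y) x = \<alpha> * U f x + \<beta> * U g x"
  using assms by (auto simp: L2_unitary_def)

text \<open>\<open>U\<close> is linear only up to null sets, so the difference is taken as a
  combination with coefficients 1 and -1, to which the isometry applies.\<close>

lemma L2_unitary_dist:
  assumes "L2_unitary M U" "f \<in> Lp_space 2 M" "g \<in> Lp_space 2 M"
  shows "(\<integral>\<^sup>+ x. (norm (U f x - U g x))\<^sup>2 \<partial>M) = (\<integral>\<^sup>+ x. (norm (f x - g x))\<^sup>2 \<partial>M)"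
proof -
  have "(\<integral>\<^sup>+ x. (norm (U f x - U g x))\<^sup>2 \<partial>M) =
      (\<integral>\<^sup>+ x. (norm (U (\<lambda>y. 1 * f y + (-1) * g y) x))\<^sup>2 \<partial>M)"
    using L2_unitary_linear[OF assms, of 1 "-1"] by (intro nn_integral_cong_AE) auto
  also have "\<dots> = (\<integral>\<^sup>+ x. (norm (f x - g x))\<^sup>2 \<partial>M)"
    using L2_unitary_isometry_nn[OF assms(1) Lp_space_2_add[OF assms(2,3)], of 1 "-1"] by simp
  finally show ?thesis .
qed

text \<open>Surjectivity makes the choice in \<open>L2_inv\<close> a true preimage up to a null set,
  and a preimage has the norm of its image.\<close>

lemma L2_inv_isometry:
  assumes U: "L2_unitary M U" and g: "g \<in> Lp_space 2 M"
  shows "Lp_norm 2 M (L2_inv M U g) = Lp_norm 2 M g"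
proof -
  have "\<exists>f. f \<in> Lp_space 2 M \<and> (AE x in M. U f x = g x)"
    using assms unfolding L2_unitary_def by blast
  from someI_ex[OF this]
  have *: "L2_inv M U g \<in> Lp_space 2 M" "AE x in M. U (L2_inv M U g) x = g x"
    by (auto simp: L2_inv_def)
  have "(\<integral>\<^sup>+ x. (norm (L2_inv M U g x))\<^sup>2 \<partial>M) = (\<integral>\<^sup>+ x. (norm (g x))\<^sup>2 \<partial>M)"
    unfolding L2_unitary_isometry_nn[OF U *(1), symmetric]
    using *(2) by (intro nn_integral_cong_AE) auto
  then show ?thesis by (simp add: Lp_norm_def)
qed

subsection \<open>The unitary extension agrees with the integral operator\<close>

context cone_transform
begin

lemma space_mu: "space \<mu> = \<Omega>"
  using sets_eq_imp_space_eq[OF sets_mu] by (simp add: space_restrict_space)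

lemma borel_measurable_mu:
  "f \<in> borel_measurable borel \<Longrightarrow> f \<in> borel_measurable \<mu>"
  unfolding measurable_cong_sets[OF sets_mu refl] by (rule measurable_restrict_space1)

lemma borel_measurable_norm_mu [measurable]: "norm \<in> borel_measurable \<mu>"
  by (rule borel_measurable_mu) simp

lemma K_bound: obtains c where "0 < c" "\<And>x \<xi>. x \<in> \<Omega> \<Longrightarrow> \<xi> \<in> \<Omega> \<Longrightarrow> norm (K x \<xi>) \<le> c"
proof -
  from K_bounded obtain c where c: "\<And>x \<xi>. x \<in> \<Omega> \<Longrightarrow> \<xi> \<in> \<Omega> \<Longrightarrow> norm (K x \<xi>) \<le> c" by blast
  \<comment> \<open>The maximum with 1 makes the bound positive, and with it all constants built
    from it.\<close>
  show thesis by (rule that[of "max c 1"]) (auto intro: order_trans[OF c])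
qed

text \<open>Continuity on \<open>\<Omega>\<close> suffices because \<open>sets \<mu>\<close> is the
  trace of the Borel sets on \<open>\<Omega>\<close>.\<close>

lemma K_measurable: "\<xi> \<in> \<Omega> \<Longrightarrow> (\<lambda>x. K x \<xi>) \<in> borel_measurable \<mu>"
  unfolding measurable_cong_sets[OF sets_mu refl]
  by (intro borel_measurable_continuous_on_restrict
        continuous_on_compose2[OF K_continuous, of _ "\<lambda>x. (x, \<xi>)", simplified])
     (auto intro!: continuous_intros)

lemma integrable_times_K:
  assumes f: "integrable \<mu> f" and \<xi>: "\<xi> \<in> \<Omega>"
  shows "integrable \<mu> (\<lambda>x. f x * K x \<xi>)"
proof -
  obtain c where c: "0 < c" "\<And>x \<xi>. x \<in> \<Omega> \<Longrightarrow> \<xi> \<in> \<Omega> \<Longrightarrow> norm (K x \<xi>) \<le> c"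
    using K_bound by blast
  have [measurable]: "(\<lambda>x. K x \<xi>) \<in> borel_measurable \<mu>" "f \<in> borel_measurable \<mu>"
    using \<xi> f K_measurable by auto
  have "integrable \<mu> (\<lambda>x. norm (f x) * c)" using f by simp
  then show ?thesis
  proof (rule Bochner_Integration.integrable_bound)
    show "AE x in \<mu>. norm (f x * K x \<xi>) \<le> norm (norm (f x) * c)"
      using c \<xi> by (intro AE_I2) (auto simp: norm_mult space_mu intro!: mult_left_mono)
  qed measurable
qed

lemma int_op_bound:
  assumes c: "\<And>x \<xi>. x \<in> \<Omega> \<Longrightarrow> \<xi> \<in> \<Omega> \<Longrightarrow> norm (K x \<xi>) \<le> c"
    and f: "integrable \<mu> f" and \<xi>: "\<xi> \<in> \<Omega>"
  shows "norm (int_op \<mu> K f \<xi>) \<le> c * (\<integral> x. norm (f x) \<partial>\<mu>)"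
proof -
  have "norm (int_op \<mu> K f \<xi>) \<le> (\<integral> x. norm (f x * K x \<xi>) \<partial>\<mu>)"
    unfolding int_op_def by (rule integral_norm_bound)
  also have "\<dots> \<le> (\<integral> x. c * norm (f x) \<partial>\<mu>)"
  proof (rule integral_mono)
    show "integrable \<mu> (\<lambda>x. norm (f x * K x \<xi>))"
      using integrable_times_K[OF f \<xi>] by (rule integrable_norm)
    show "norm (f x * K x \<xi>) \<le> c * norm (f x)" if "x \<in> space \<mu>" for x
      using mult_left_mono[OF c[of x \<xi>] norm_ge_zero[of "f x"]] that \<xi>
      by (simp add: norm_mult space_mu mult.commute)
  qed (use f in simp)
  finally show ?thesis by simp
qed

text \<open>The lemmas below enlarge this class step by step: Gaussians times tame functions, times
  indicators of Borel sets, times nonnegative functions, and finally all functions in both spaces.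
  The two memberships are carried along because linearity of the integral operator needs L1 and
  linearity of \<open>T2\<close> needs L2.\<close>

definition agrees :: "('a \<Rightarrow> complex) \<Rightarrow> bool" where
  "agrees f \<longleftrightarrow> f \<in> Lp_space 1 \<mu> \<inter> Lp_space 2 \<mu> \<and> (AE \<xi> in \<mu>. T2 f \<xi> = int_op \<mu> K f \<xi>)"

lemma agrees_linear:
  assumes f: "agrees f" and g: "agrees g"
  shows "agrees (\<lambda>x. \<alpha> * f x + \<beta> * g x)"
proof -
  have L: "f \<in> Lp_space 2 \<mu>" "g \<in> Lp_space 2 \<mu>" "integrable \<mu> f" "integrable \<mu> g"
    using assms by (auto simp: agrees_def Lp_space_1_iff)
  have "int_op \<mu> K (\<lambda>x. \<alpha> * f x + \<beta> * g x) \<xi> = \<alpha> * int_op \<mu> K f \<xi> + \<beta> * int_op \<mu> K g \<xi>"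
    if "\<xi> \<in> \<Omega>" for \<xi>
    using integrable_times_K[OF L(3) that] integrable_times_K[OF L(4) that]
    by (simp add: int_op_def distrib_right mult.assoc)
  then have "AE \<xi> in \<mu>. int_op \<mu> K (\<lambda>x. \<alpha> * f x + \<beta> * g x) \<xi> =
      \<alpha> * int_op \<mu> K f \<xi> + \<beta> * int_op \<mu> K g \<xi>"
    by (intro AE_I2) (simp add: space_mu)
  moreover have "AE \<xi> in \<mu>. T2 f \<xi> = int_op \<mu> K f \<xi>" "AE \<xi> in \<mu>. T2 g \<xi> = int_op \<mu> K g \<xi>"
    using assms by (auto simp: agrees_def)
  ultimately have "AE \<xi> in \<mu>. T2 (\<lambda>x. \<alpha> * f x + \<beta> * g x) \<xi> =
      int_op \<mu> K (\<lambda>x. \<alpha> * f x + \<beta> * g x) \<xi>"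
    using L2_unitary_linear[OF T2_unitary L(1,2), of \<alpha> \<beta>] by eventually_elim simp
  then show ?thesis
    using L Lp_space_2_add[OF L(1,2)] by (simp add: agrees_def Lp_space_1_iff)
qed

text \<open>The images under \<^term>\<open>T2\<close> converge in \<open>L\<^sup>2\<close>, those under the integral operator
  pointwise; Fatou's lemma identifies the two limits without passing to a subsequence.\<close>

lemma agrees_dominated_limit:
  fixes g :: "'a \<Rightarrow> real"
  assumes F: "\<And>n. agrees (F n)"
    and g: "integrable \<mu> g" "integrable \<mu> (\<lambda>x. (g x)\<^sup>2)"
    and bound: "\<And>n x. x \<in> \<Omega> \<Longrightarrow> norm (F n x) \<le> g x"
    and lim: "\<And>x. x \<in> \<Omega> \<Longrightarrow> (\<lambda>n. F n x) \<longlonglongrightarrow> f x"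
  shows "agrees f"
proof -
  have F_meas [measurable]: "F n \<in> borel_measurable \<mu>" for n
    using F[of n] by (auto simp: agrees_def Lp_space_2_iff)
  have f_meas [measurable]: "f \<in> borel_measurable \<mu>"
    by (rule borel_measurable_LIMSEQ_metric[where f = F]) (use lim in \<open>auto simp: space_mu\<close>)
  have f_bound: "norm (f x) \<le> g x" if "x \<in> \<Omega>" for x
    using tendsto_norm[OF lim[OF that]] bound[OF that] by (intro LIMSEQ_le_const2) auto
  have f: "f \<in> Lp_space 1 \<mu> \<inter> Lp_space 2 \<mu>"
    by (rule Lp_space_12_bound[OF f_meas g]) (simp add: space_mu f_bound)
  have F2: "F n \<in> Lp_space 2 \<mu>" for n using F[of n] by (simp add: agrees_def)
  have T2_meas [measurable]: "T2 (F n) \<in> borel_measurable \<mu>" "T2 f \<in> borel_measurable \<mu>" for n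
    using T2_unitary F2[of n] f by (auto simp: L2_unitary_def Lp_space_2_iff)
  have int_op_lim: "(\<lambda>n. int_op \<mu> K (F n) \<xi>) \<longlonglongrightarrow> int_op \<mu> K f \<xi>" if \<xi>: "\<xi> \<in> \<Omega>" for \<xi>
  proof -
    obtain c where c: "0 < c" "\<And>x \<xi>. x \<in> \<Omega> \<Longrightarrow> \<xi> \<in> \<Omega> \<Longrightarrow> norm (K x \<xi>) \<le> c"
      using K_bound by blast
    have [measurable]: "(\<lambda>x. K x \<xi>) \<in> borel_measurable \<mu>" using \<xi> by (rule K_measurable)
    show ?thesis
      unfolding int_op_def
    proof (rule integral_dominated_convergence)
      show "integrable \<mu> (\<lambda>x. g x * c)" using g by simp
      show "AE x in \<mu>. (\<lambda>n. F n x * K x \<xi>) \<longlonglongrightarrow> f x * K x \<xi>"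
        by (intro AE_I2 tendsto_intros lim) (simp add: space_mu)
      show "AE x in \<mu>. norm (F n x * K x \<xi>) \<le> g x * c" for n
      proof (rule AE_I2)
        fix x assume x: "x \<in> space \<mu>"
        then have "0 \<le> g x" using order_trans[OF norm_ge_zero bound] by (auto simp: space_mu)
        then show "norm (F n x * K x \<xi>) \<le> g x * c"
          using x \<xi> c bound by (auto simp: norm_mult space_mu intro!: mult_mono)
      qed
    qed measurable
  qed
  \<comment> \<open>The limit inherits the bound \<open>g\<close>, so the differences are at most 2g
    and 4g^2 dominates their squares.\<close>
  have conv: "(\<lambda>n. \<integral>\<^sup>+ x. (norm (F n x - f x))\<^sup>2 \<partial>\<mu>) \<longlonglongrightarrow> (\<integral>\<^sup>+ x. 0 \<partial>\<mu>)"
  proof (rule nn_integral_dominated_convergence)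
    show "(\<integral>\<^sup>+ x. ennreal (4 * (g x)\<^sup>2) \<partial>\<mu>) < \<infinity>"
      by (subst nn_integral_eq_integral) (use g in auto)
    show "AE x in \<mu>. ennreal ((norm (F n x - f x))\<^sup>2) \<le> ennreal (4 * (g x)\<^sup>2)" for n
    proof (rule AE_I2)
      fix x assume x: "x \<in> space \<mu>"
      then have "norm (F n x - f x) \<le> 2 * g x"
        using norm_triangle_ineq4[of "F n x" "f x"] bound[of x n] f_bound[of x] by (simp add: space_mu)
      then have "(norm (F n x - f x))\<^sup>2 \<le> (2 * g x)\<^sup>2" by (intro power_mono) auto
      then show "ennreal ((norm (F n x - f x))\<^sup>2) \<le> ennreal (4 * (g x)\<^sup>2)"
        by (intro ennreal_leI) (simp add: power_mult_distrib)
    qed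
    show "AE x in \<mu>. (\<lambda>n. ennreal ((norm (F n x - f x))\<^sup>2)) \<longlonglongrightarrow> 0"
    proof (rule AE_I2)
      fix x assume x: "x \<in> space \<mu>"
      have "(\<lambda>n. (norm (F n x - f x))\<^sup>2) \<longlonglongrightarrow> (norm (f x - f x))\<^sup>2"
        using x by (intro tendsto_intros lim) (simp add: space_mu)
      then have "(\<lambda>n. ennreal ((norm (F n x - f x))\<^sup>2)) \<longlonglongrightarrow> ennreal ((norm (f x - f x))\<^sup>2)"
        by (rule tendsto_ennrealI)
      then show "(\<lambda>n. ennreal ((norm (F n x - f x))\<^sup>2)) \<longlonglongrightarrow> 0" by simp
    qed
  qed (use g in measurable)
  \<comment> \<open>The indices are countable, so one null set serves all of them.\<close>
  have "AE \<xi> in \<mu>. \<forall>n. T2 (F n) \<xi> = int_op \<mu> K (F n) \<xi>"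
    using F by (auto simp: agrees_def AE_all_countable)
  then have "AE \<xi> in \<mu>. liminf (\<lambda>n. ennreal ((norm (T2 (F n) \<xi> - T2 f \<xi>))\<^sup>2)) =
      ennreal ((norm (int_op \<mu> K f \<xi> - T2 f \<xi>))\<^sup>2)"
    using AE_space
  proof eventually_elim
    case (elim \<xi>)
    then have "(\<lambda>n. T2 (F n) \<xi>) \<longlonglongrightarrow> int_op \<mu> K f \<xi>"
      using int_op_lim[of \<xi>] by (simp add: space_mu)
    then have "(\<lambda>n. ennreal ((norm (T2 (F n) \<xi> - T2 f \<xi>))\<^sup>2)) \<longlonglongrightarrow>
        ennreal ((norm (int_op \<mu> K f \<xi> - T2 f \<xi>))\<^sup>2)"
      by (intro tendsto_intros tendsto_ennrealI)
    then show ?case by (rule lim_imp_Liminf[OF sequentially_bot])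
  qed
  moreover have "(\<integral>\<^sup>+ \<xi>. liminf (\<lambda>n. ennreal ((norm (T2 (F n) \<xi> - T2 f \<xi>))\<^sup>2)) \<partial>\<mu>) = 0"
  proof -
    have "(\<integral>\<^sup>+ \<xi>. liminf (\<lambda>n. ennreal ((norm (T2 (F n) \<xi> - T2 f \<xi>))\<^sup>2)) \<partial>\<mu>) \<le>
        liminf (\<lambda>n. \<integral>\<^sup>+ \<xi>. (norm (T2 (F n) \<xi> - T2 f \<xi>))\<^sup>2 \<partial>\<mu>)"
      by (rule nn_integral_liminf) measurable
    also have "\<dots> = liminf (\<lambda>n. \<integral>\<^sup>+ x. (norm (F n x - f x))\<^sup>2 \<partial>\<mu>)"
      using L2_unitary_dist[OF T2_unitary F2] f by simp
    also have "\<dots> = 0"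
      using lim_imp_Liminf[OF sequentially_bot conv] by simp
    finally show ?thesis by simp
  qed
  then have "AE \<xi> in \<mu>. liminf (\<lambda>n. ennreal ((norm (T2 (F n) \<xi> - T2 f \<xi>))\<^sup>2)) = 0"
    by (subst (asm) nn_integral_0_iff_AE) auto
  ultimately have "AE \<xi> in \<mu>. T2 f \<xi> = int_op \<mu> K f \<xi>"
    by eventually_elim (auto simp: ennreal_eq_0_iff)
  with f show ?thesis by (simp add: agrees_def)
qed

section \<open>Growth of the measure of balls and integrability of the Gaussian\<close>

text \<open>In polar form each ray contributes at most the integral of r^(2a-1) over [0,R], that is
  R^(2a)/(2a), and \<open>Q\<close> has a finite integral over the sphere.\<close>

lemma emeasure_cball_le:
  obtains \<kappa> where "0 < \<kappa>"
    "\<And>R. 0 < R \<Longrightarrow> emeasure \<mu> (\<Omega> \<inter> cball 0 R) \<le> ennreal (\<kappa> * R powr (2 * a))"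
proof -
  define q where "q = enn2real (\<integral>\<^sup>+ \<zeta>. ennreal (Q \<zeta>) \<partial>surface_measure)"
  have "(\<integral>\<^sup>+ \<zeta>. ennreal (Q \<zeta>) \<partial>surface_measure) \<le> (\<integral>\<^sup>+ \<zeta>. ennreal (norm (Q \<zeta>)) \<partial>surface_measure)"
    by (intro nn_integral_mono ennreal_leI) auto
  also have "\<dots> < \<infinity>" using Q_L1 by (simp add: integrable_iff_bounded)
  finally have q: "(\<integral>\<^sup>+ \<zeta>. ennreal (Q \<zeta>) \<partial>surface_measure) = ennreal q"
    by (simp add: q_def less_top)
  have q0: "0 \<le> q" by (simp add: q_def)
  \<comment> \<open>The added 1 makes the constant positive from \<open>0 \<le> q\<close>
    alone.\<close>
  have le: "emeasure \<mu> (\<Omega> \<inter> cball 0 R) \<le> ennreal ((q / (2 * a) + 1) * R powr (2 * a))"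
    if R: "0 < R" for R
  proof -
    have A: "\<Omega> \<inter> cball 0 R \<in> sets \<mu>"
      by (auto simp: sets_mu sets_restrict_space)
    have radial: "(\<integral>\<^sup>+ r\<in>{0<..}. indicator (\<Omega> \<inter> cball 0 R) (r *\<^sub>R \<zeta>) * ennreal (r powr (2 * a - 1)) \<partial>lborel)
        \<le> ennreal (R powr (2 * a) / (2 * a))" if "\<zeta> \<in> space surface_measure" for \<zeta> :: 'a
    proof -
      have \<zeta>: "norm \<zeta> = 1"
        using that by (simp add: surface_measure_def space_restrict_space space_scale_measure)
      have "(\<integral>\<^sup>+ r\<in>{0<..}. indicator (\<Omega> \<inter> cball 0 R) (r *\<^sub>R \<zeta>) * ennreal (r powr (2 * a - 1)) \<partial>lborel)
        \<le> (\<integral>\<^sup>+ r. ennreal (r powr (2 * a - 1)) * indicator {0..R} r \<partial>lborel)"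
        using \<zeta> by (intro nn_integral_mono) (auto simp: indicator_def)
      also have "\<dots> = ennreal (R powr (2 * a - 1 + 1) / (2 * a - 1 + 1))"
        using R a_pos by (intro nn_integral_has_integral_lebesgue' has_integral_powr_from_0) auto
      finally show ?thesis by simp
    qed
    have "emeasure \<mu> (\<Omega> \<inter> cball 0 R) \<le>
        (\<integral>\<^sup>+ \<zeta>. ennreal (R powr (2 * a) / (2 * a)) * ennreal (Q \<zeta>) \<partial>surface_measure)"
      unfolding polar[OF A] by (intro nn_integral_mono mult_right_mono radial) auto
    also have "\<dots> = ennreal (R powr (2 * a) / (2 * a)) * ennreal q"
      unfolding q[symmetric] using Q_L1 by (intro nn_integral_cmult) auto
    also have "\<dots> = ennreal (R powr (2 * a) / (2 * a) * q)"
      using a_pos q0 by (intro ennreal_mult[symmetric]) auto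
    also have "\<dots> \<le> ennreal ((q / (2 * a) + 1) * R powr (2 * a))"
      using a_pos by (intro ennreal_leI) (simp add: field_simps)
    finally show ?thesis .
  qed
  show thesis
    by (rule that[OF _ le]) (use q0 a_pos in \<open>auto intro: add_nonneg_pos\<close>)
qed

text \<open>Where the norm lies between n and n + 1 the Gaussian is at most exp(-n^2), while the
  ball of radius n + 1 has measure at most \<open>\<kappa> * (real n + 1) powr (2 * a)\<close>; the
  products are summable.\<close>

lemma integrable_gauss: "integrable \<mu> gauss"
proof -
  obtain \<kappa> where \<kappa>: "0 < \<kappa>"
    "\<And>R. 0 < R \<Longrightarrow> emeasure \<mu> (\<Omega> \<inter> cball 0 R) \<le> ennreal (\<kappa> * R powr (2 * a))"
    using emeasure_cball_le by blast
  define B where "B n = \<Omega> \<inter> cball 0 (real n + 1)" for n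
  have B [measurable]: "B n \<in> sets \<mu>" for n
    by (auto simp: B_def sets_mu sets_restrict_space)
  define c where "c n = exp (- (real n)\<^sup>2) * (\<kappa> * (real n + 1) powr (2 * a))" for n
  have c0: "0 \<le> c n" for n using \<kappa>(1) by (simp add: c_def)
  have "c \<in> O(\<lambda>n. 1 / real n ^ 2)" unfolding c_def using a_pos by real_asymp
  then have "summable c"
    by (rule summable_comparison_test_bigo[rotated]) (use inverse_power_summable[of 2, where 'a = real] in \<open>auto simp: inverse_eq_divide\<close>)
  have "(\<integral>\<^sup>+ x. ennreal (gauss x) \<partial>\<mu>) \<le>
      (\<integral>\<^sup>+ x. (\<Sum>n. ennreal (exp (- (real n)\<^sup>2)) * indicator (B n) x) \<partial>\<mu>)"
  proof (rule nn_integral_mono)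
    fix x assume x: "x \<in> space \<mu>"
    define n where "n = nat \<lfloor>norm x\<rfloor>"
    have n: "real n \<le> norm x" "norm x \<le> real n + 1"
      unfolding n_def using norm_ge_zero[of x] by (simp_all only: of_nat_nat of_int_floor_le zero_le_floor) linarith+
    have "(real n)\<^sup>2 \<le> x \<bullet> x"
      unfolding power2_norm_eq_inner[symmetric] using n by (intro power_mono) auto
    \<comment> \<open>The term whose index is the floor of the norm already dominates; the other
      terms are nonnegative.\<close>
    then have "ennreal (gauss x) \<le> ennreal (exp (- (real n)\<^sup>2)) * indicator (B n) x"
      using n x by (auto simp: gauss_def B_def space_mu intro!: ennreal_leI)
    also have "\<dots> \<le> (\<Sum>n. ennreal (exp (- (real n)\<^sup>2)) * indicator (B n) x)"
      using sum_le_suminf[of "\<lambda>n. ennreal (exp (- (real n)\<^sup>2)) * indicator (B n) x" "{n}"]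
      by (simp del: sum_mult_indicator)
    finally show "ennreal (gauss x) \<le> (\<Sum>n. ennreal (exp (- (real n)\<^sup>2)) * indicator (B n) x)" .
  qed
  also have "\<dots> = (\<Sum>n. \<integral>\<^sup>+ x. ennreal (exp (- (real n)\<^sup>2)) * indicator (B n) x \<partial>\<mu>)"
    by (rule nn_integral_suminf) measurable
  also have "\<dots> \<le> (\<Sum>n. ennreal (c n))"
  proof (rule suminf_le)
    fix n
    have "(\<integral>\<^sup>+ x. ennreal (exp (- (real n)\<^sup>2)) * indicator (B n) x \<partial>\<mu>) =
        ennreal (exp (- (real n)\<^sup>2)) * emeasure \<mu> (B n)"
      by (rule nn_integral_cmult_indicator) measurable
    also have "\<dots> \<le> ennreal (exp (- (real n)\<^sup>2)) * ennreal (\<kappa> * (real n + 1) powr (2 * a))"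
      unfolding B_def by (intro mult_left_mono \<kappa>) auto
    also have "\<dots> = ennreal (c n)" using \<kappa>(1) by (simp add: c_def ennreal_mult)
    finally show "(\<integral>\<^sup>+ x. ennreal (exp (- (real n)\<^sup>2)) * indicator (B n) x \<partial>\<mu>) \<le> ennreal (c n)" .
  qed auto
  also have "\<dots> < \<infinity>"
    using \<open>summable c\<close> c0 by (simp add: suminf_ennreal2)
  finally show ?thesis
    using borel_measurable_mu[OF gauss_measurable]
    by (simp add: integrable_iff_bounded less_imp_le[OF gauss_pos])
qed

lemma integrable_gauss_power2: "integrable \<mu> (\<lambda>x. (gauss x)\<^sup>2)"
  using integrable_gauss
proof (rule Bochner_Integration.integrable_bound)
  show "AE x in \<mu>. norm ((gauss x)\<^sup>2) \<le> norm (gauss x)"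
    by (intro AE_I2) (simp add: power2_eq_square abs_of_pos[OF gauss_pos]
        mult_left_le[OF gauss_le_1 less_imp_le[OF gauss_pos]])
qed (use borel_measurable_mu[OF gauss_measurable] in measurable)

section \<open>Agreement of the two transforms, from Gaussians to all functions in L1 and L2\<close>

lemma agrees_gauss_tame:
  assumes h: "tame h" and bound: "\<And>x. \<bar>h x\<bar> \<le> 1"
  shows "agrees (\<lambda>x. complex_of_real (gauss x * h x))"
proof -
  have "continuous_on UNIV h"
    using tame_has_derivative[OF h]
    by (auto simp: continuous_on_eq_continuous_at intro: has_derivative_continuous)
  then have [measurable]: "h \<in> borel_measurable \<mu>"
    by (intro borel_measurable_mu borel_measurable_continuous_onI)
  have [measurable]: "gauss \<in> borel_measurable \<mu>"
    by (rule borel_measurable_mu) measurable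
  have "(\<lambda>x. complex_of_real (gauss x * h x)) \<in> Lp_space 1 \<mu> \<inter> Lp_space 2 \<mu>"
  proof (rule Lp_space_12_bound[OF _ integrable_gauss integrable_gauss_power2])
    show "norm (complex_of_real (gauss x * h x)) \<le> gauss x" for x
      using mult_left_mono[OF bound[of x] less_imp_le[OF gauss_pos[of x]]]
      by (simp add: abs_mult less_imp_le[OF gauss_pos] del: of_real_mult)
  qed measurable
  moreover have "AE \<xi> in \<mu>. T2 (\<lambda>x. complex_of_real (gauss x * h x)) \<xi> =
      int_op \<mu> K (\<lambda>x. complex_of_real (gauss x * h x)) \<xi>"
    by (rule T2_extends) (use schwartz_gauss_tame[OF h] in \<open>auto simp: schwartz_on_def\<close>)
  ultimately show ?thesis by (simp add: agrees_def)
qed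

lemma agrees_gauss_limit:
  assumes F: "\<And>n. agrees (\<lambda>x. complex_of_real (gauss x * F n x))"
    and bound: "\<And>n x. \<bar>F n x\<bar> \<le> 1"
    and lim: "\<And>x. (\<lambda>n. F n x) \<longlonglongrightarrow> f x"
  shows "agrees (\<lambda>x. complex_of_real (gauss x * f x))"
proof (rule agrees_dominated_limit[OF F integrable_gauss integrable_gauss_power2])
  show "norm (complex_of_real (gauss x * F n x)) \<le> gauss x" for n x
    using mult_left_mono[OF bound[of n x] less_imp_le[OF gauss_pos[of x]]]
    by (simp add: abs_mult less_imp_le[OF gauss_pos] del: of_real_mult)
  show "(\<lambda>n. complex_of_real (gauss x * F n x)) \<longlonglongrightarrow> complex_of_real (gauss x * f x)" for x
    by (intro tendsto_intros lim)
qed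

text \<open>Boxes are stable under intersection and generate the Borel sets. Linearity handles
  complements, dominated limits handle boxes and countable disjoint unions. The Gaussian weight
  keeps everything in both spaces even if \<open>A\<close> has infinite measure.\<close>

lemma agrees_gauss_indicator:
  assumes "A \<in> sets borel"
  shows "agrees (\<lambda>x. complex_of_real (gauss x * indicator A x))"
proof -
  let ?G = "range (\<lambda>(l, u). box l u) :: 'a set set"
  have "Int_stable ?G"
    by (auto simp: Int_stable_def box_Int_box)
  moreover have "?G \<subseteq> Pow UNIV" by simp
  moreover have "A \<in> sigma_sets UNIV ?G"
    using assms by (simp add: borel_eq_box)
  ultimately show ?thesis
  proof (induction A rule: sigma_sets_induct_disjoint)
    case (basic A)
    then obtain l u where A: "A = box l u" by auto
    show ?case unfolding A
      by (rule agrees_gauss_limit[OF agrees_gauss_tame[OF tame_box_approx] _ box_approx_tendsto])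
         (simp_all add: box_approx_bounds)
  next
    case empty
    show ?case using agrees_gauss_tame[OF tame.const[of 0]] by simp
  next
    case (compl A)
    from agrees_linear[OF agrees_gauss_tame[OF tame.const[of 1]] compl(2), of 1 "-1"]
    have "agrees (\<lambda>x. complex_of_real (gauss x) - complex_of_real (gauss x * indicator A x))" by simp
    also have "(\<lambda>x. complex_of_real (gauss x) - complex_of_real (gauss x * indicator A x)) =
        (\<lambda>x. complex_of_real (gauss x * indicator (UNIV - A) x))"
      by (auto simp: indicator_def)
    finally show ?case .
  next
    case (union A)
    have partial: "agrees (\<lambda>x. complex_of_real (gauss x * indicator (\<Union>i<n. A i) x))" for n
    proof (induction n)
      case 0
      show ?case using agrees_gauss_tame[OF tame.const[of 0]] by simp
    next
      case (Suc n)
      \<comment> \<open>Disjointness makes the indicator of the partial union a sum of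
        indicators.\<close>
      have "A n \<inter> A i = {}" if "i < n" for i
        using that by (intro disjoint_family_onD[OF union(1)]) auto
      then have "A n \<inter> (\<Union>i<n. A i) = {}" by blast
      then have "(\<lambda>x. complex_of_real (gauss x * indicator (\<Union>i<Suc n. A i) x)) =
          (\<lambda>x. 1 * complex_of_real (gauss x * indicator (\<Union>i<n. A i) x) +
               1 * complex_of_real (gauss x * indicator (A n) x))"
        by (auto simp: fun_eq_iff indicator_def lessThan_Suc)
      then show ?case using agrees_linear[OF Suc union(3), of 1 1] by simp
    qed
    show ?case
      by (rule agrees_gauss_limit[OF partial _ LIMSEQ_indicator_UN]) (auto simp: indicator_def)
  qed
qed

text \<open>\<open>T2\<close> receives functions on the whole type, so values outside
  \<open>\<Omega>\<close> have to be shown harmless: the constant sequence \<open>f\<close>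
  converges to \<open>g\<close> on \<open>\<Omega>\<close> and is dominated by its own norm.\<close>

lemma agrees_cong:
  assumes "agrees f" "\<And>x. x \<in> \<Omega> \<Longrightarrow> f x = g x"
  shows "agrees g"
  by (rule agrees_dominated_limit[where F = "\<lambda>_. f" and g = "\<lambda>x. norm (f x)"])
     (use assms in \<open>auto simp: agrees_def Lp_space_1_iff Lp_space_2_iff\<close>)

text \<open>Induction along indicators, scalings, sums and monotone limits. The integrability
  premises take part in the induction: each constituent of \<open>u\<close> inherits them, by
  division in the scalar case and by domination in sums and limits.\<close>

lemma agrees_gauss_nonneg:
  assumes "u \<in> borel_measurable \<mu>" "\<And>x. 0 \<le> u x"
    and "integrable \<mu> (\<lambda>x. gauss x * u x)" "integrable \<mu> (\<lambda>x. (gauss x * u x)\<^sup>2)"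
  shows "agrees (\<lambda>x. complex_of_real (gauss x * u x))"
  using assms
proof (induction u rule: borel_measurable_induct_real)
  case (set A)
  then obtain B where "B \<in> sets borel" "A = \<Omega> \<inter> B"
    by (auto simp: sets_mu sets_restrict_space)
  then show ?case
    by (intro agrees_cong[OF agrees_gauss_indicator[of B]]) (auto simp: indicator_def)
next
  case (mult u c)
  show ?case
  \<comment> \<open>For \<open>c = 0\<close> nothing can be recovered about \<open>u\<close>, but
    the product is the zero function.\<close>
  proof (cases "c = 0")
    case True
    then show ?thesis using agrees_gauss_tame[OF tame.const[of 0]] by simp
  next
    case False
    have "integrable \<mu> (\<lambda>x. gauss x * u x)"
      using integrable_mult_right[OF mult(5), of "1 / c"] False by simp
    moreover have "integrable \<mu> (\<lambda>x. (gauss x * u x)\<^sup>2)"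
      using integrable_mult_right[OF mult(6), of "1 / c\<^sup>2"] False by (simp add: power_mult_distrib)
    ultimately have "agrees (\<lambda>x. complex_of_real (gauss x * u x))" by (rule mult.IH)
    from agrees_linear[OF this this, of c 0] show ?thesis by (simp add: mult_ac)
  qed
next
  case (add u v)
  have [measurable]: "u \<in> borel_measurable \<mu>" "v \<in> borel_measurable \<mu>"
    "gauss \<in> borel_measurable \<mu>" "\<And>x. 0 \<le> u x" "\<And>x. 0 \<le> v x"
    using add borel_measurable_mu[OF gauss_measurable] by auto
  have g0: "0 \<le> gauss x" for x :: 'a using gauss_pos[of x] by simp
  have "agrees (\<lambda>x. complex_of_real (gauss x * u x))"
  proof (rule add.IH)
    show "integrable \<mu> (\<lambda>x. gauss x * u x)"
      using add(8) by (rule Bochner_Integration.integrable_bound)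
        (use add g0 in \<open>auto simp: algebra_simps\<close>)
    show "integrable \<mu> (\<lambda>x. (gauss x * u x)\<^sup>2)"
      using add(9) by (rule Bochner_Integration.integrable_bound)
        (use add g0 in \<open>auto intro!: power_mono mult_left_mono\<close>)
  qed
  moreover have "agrees (\<lambda>x. complex_of_real (gauss x * v x))"
  proof (rule add.IH)
    show "integrable \<mu> (\<lambda>x. gauss x * v x)"
      using add(8) by (rule Bochner_Integration.integrable_bound)
        (use add g0 in \<open>auto simp: algebra_simps\<close>)
    show "integrable \<mu> (\<lambda>x. (gauss x * v x)\<^sup>2)"
      using add(9) by (rule Bochner_Integration.integrable_bound)
        (use add g0 in \<open>auto intro!: power_mono mult_left_mono\<close>)
  qed
  ultimately show ?case
    using agrees_linear[of "\<lambda>x. complex_of_real (gauss x * v x)" "\<lambda>x. complex_of_real (gauss x * u x)" 1 1]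
    by (simp add: distrib_left)
next
  case (seq U)
  have [measurable]: "\<And>i. U i \<in> borel_measurable \<mu>" "gauss \<in> borel_measurable \<mu>"
    using seq borel_measurable_mu[OF gauss_measurable] by auto
  have g0: "0 \<le> gauss x" for x :: 'a using gauss_pos[of x] by simp
  have U_le: "U i x \<le> u x" if "x \<in> \<Omega>" for i x
    using seq.hyps(3,4) that by (intro incseq_le) (auto simp: space_mu incseq_def le_fun_def)
  have "agrees (\<lambda>x. complex_of_real (gauss x * U i x))" for i
  proof (rule seq.IH)
    show "integrable \<mu> (\<lambda>x. gauss x * U i x)"
      using seq.prems(1) by (rule Bochner_Integration.integrable_bound)
        (use seq.hyps g0 in \<open>auto simp: abs_mult space_mu
           intro!: AE_I2 mult_left_mono order_trans[OF U_le abs_ge_self]\<close>)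
    show "integrable \<mu> (\<lambda>x. (gauss x * U i x)\<^sup>2)"
      using seq.prems(2) by (rule Bochner_Integration.integrable_bound)
        (use seq.hyps g0 U_le in \<open>auto simp: space_mu intro!: power_mono mult_left_mono\<close>)
  qed
  \<comment> \<open>The limit \<open>gauss x * u x\<close> itself is the dominating
    function.\<close>
  then show ?case
    using seq.prems
  proof (rule agrees_dominated_limit[where F = "\<lambda>i x. complex_of_real (gauss x * U i x)"])
    show "norm (complex_of_real (gauss x * U n x)) \<le> gauss x * u x" if "x \<in> \<Omega>" for n x
      using mult_left_mono[OF U_le[OF that] g0] seq.hyps(2) g0
      by (simp add: abs_mult del: of_real_mult)
    show "(\<lambda>n. complex_of_real (gauss x * U n x)) \<longlonglongrightarrow> complex_of_real (gauss x * u x)"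
      if "x \<in> \<Omega>" for x
      using that seq.hyps(4) by (intro tendsto_intros) (simp add: space_mu)
  qed
qed

text \<open>The Gaussian never vanishes, so each of the positive and negative parts is a Gaussian
  times a nonnegative quotient.\<close>

lemma agrees_real:
  assumes h: "integrable \<mu> h" "integrable \<mu> (\<lambda>x. (h x)\<^sup>2)"
  shows "agrees (\<lambda>x. complex_of_real (h x))"
proof -
  have [measurable]: "gauss \<in> borel_measurable \<mu>" "h \<in> borel_measurable \<mu>"
    using h borel_measurable_mu[OF gauss_measurable] by auto
  have nz: "gauss x \<noteq> 0" for x :: 'a using gauss_pos[of x] by simp
  \<comment> \<open>Here \<open>k\<close> stands for \<open>h\<close> or \<open>- h\<close>, which
    covers both parts at once.\<close>
  have pos: "agrees (\<lambda>x. complex_of_real (max 0 (k x)))"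
    if k: "k \<in> borel_measurable \<mu>" "\<And>x. \<bar>k x\<bar> = \<bar>h x\<bar>" for k
  proof -
    note [measurable] = k(1)
    have "integrable \<mu> (\<lambda>x. max 0 (k x))"
      using h(1) by (rule Bochner_Integration.integrable_bound)
        (auto simp: k(2)[symmetric])
    moreover have "integrable \<mu> (\<lambda>x. (max 0 (k x))\<^sup>2)"
      using h(2) by (rule Bochner_Integration.integrable_bound)
        (auto intro!: AE_I2 abs_le_square_iff[THEN iffD1] simp: k(2)[symmetric])
    moreover have "0 \<le> max 0 (k x) / gauss x" for x
      using gauss_pos[of x] by (intro divide_nonneg_pos) auto
    ultimately show ?thesis
      using agrees_gauss_nonneg[of "\<lambda>x. max 0 (k x) / gauss x"] nz by simp
  qed
  have "agrees (\<lambda>x. 1 * complex_of_real (max 0 (h x)) + (-1) * complex_of_real (max 0 (- h x)))"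
    by (intro agrees_linear pos) auto
  also have "(\<lambda>x. 1 * complex_of_real (max 0 (h x)) + (-1) * complex_of_real (max 0 (- h x))) =
      (\<lambda>x. complex_of_real (h x))"
    by (auto simp: fun_eq_iff max_def)
  finally show ?thesis .
qed

text \<open>Real and imaginary parts are treated separately. The result gives one function both the
  pointwise bound of the integral operator and the L2 norm of \<open>f\<close>.\<close>

lemma T2_eq_int_op:
  assumes f: "f \<in> Lp_space 1 \<mu> \<inter> Lp_space 2 \<mu>"
  shows "AE \<xi> in \<mu>. T2 f \<xi> = int_op \<mu> K f \<xi>"
proof -
  have f12: "integrable \<mu> f" "integrable \<mu> (\<lambda>x. (norm (f x))\<^sup>2)"
    using f by (auto simp: Lp_space_1_iff Lp_space_2_iff)
  then have [measurable]: "f \<in> borel_measurable \<mu>" by auto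
  have "agrees (\<lambda>x. complex_of_real (Re (f x)))"
  proof (rule agrees_real)
    show "integrable \<mu> (\<lambda>x. (Re (f x))\<^sup>2)"
      using f12(2) by (rule Bochner_Integration.integrable_bound) (auto simp: cmod_power2)
  qed (use f12 in simp)
  moreover have "agrees (\<lambda>x. complex_of_real (Im (f x)))"
  proof (rule agrees_real)
    show "integrable \<mu> (\<lambda>x. (Im (f x))\<^sup>2)"
      using f12(2) by (rule Bochner_Integration.integrable_bound) (auto simp: cmod_power2)
  qed (use f12 in simp)
  ultimately have "agrees (\<lambda>x. 1 * complex_of_real (Re (f x)) + \<i> * complex_of_real (Im (f x)))"
    by (rule agrees_linear)
  then show ?thesis by (simp add: agrees_def complex_eq[symmetric])
qed

end

subsection \<open>The uncertainty inequalities\<close>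

lemma ennreal_power2_le_imp_le:
  assumes "(x::ennreal)\<^sup>2 \<le> (ennreal y)\<^sup>2" "0 \<le> y"
  shows "x \<le> ennreal y"
proof -
  have "x\<^sup>2 < \<infinity>" using assms(1) by (rule order_le_less_trans) (simp add: ennreal_power assms(2))
  then obtain r where r: "0 \<le> r" "x = ennreal r"
    by (cases x) (auto simp: power2_eq_square)
  with assms have "r\<^sup>2 \<le> y\<^sup>2" by (simp add: ennreal_power)
  then have "r \<le> y" using assms(2) by (rule power2_le_imp_le)
  with r show ?thesis by (simp add: ennreal_leI)
qed

text \<open>Cauchy-Schwarz against the indicator of \<open>A\<close>. The measure enters through an
  upper bound \<open>m\<close>, so the lemma serves both the set \<open>S\<close> and balls, for
  which only the growth bound is known.\<close>

lemma set_nn_integral_le_L2: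
  fixes f :: "'a \<Rightarrow> complex"
  assumes [measurable]: "f \<in> borel_measurable M" "A \<in> sets M"
    and N: "Lp_norm 2 M f = ennreal N" "0 \<le> N"
    and m: "emeasure M A \<le> ennreal m" "0 \<le> m"
  shows "(\<integral>\<^sup>+ x\<in>A. norm (f x) \<partial>M) \<le> ennreal (sqrt m * N)"
proof (rule ennreal_power2_le_imp_le)
  have "(\<integral>\<^sup>+ x\<in>A. norm (f x) \<partial>M)\<^sup>2 \<le>
      (\<integral>\<^sup>+ x. (ennreal (norm (f x)))\<^sup>2 \<partial>M) * (\<integral>\<^sup>+ x. (indicator A x)\<^sup>2 \<partial>M)"
    by (rule Cauchy_Schwarz_nn_integral) measurable
  also have "(\<integral>\<^sup>+ x. (indicator A x)\<^sup>2 \<partial>M) = (\<integral>\<^sup>+ x. indicator A x \<partial>M)"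
    by (intro nn_integral_cong) (simp add: indicator_def)
  also have "\<dots> = emeasure M A" by simp
  also have "(\<integral>\<^sup>+ x. (ennreal (norm (f x)))\<^sup>2 \<partial>M) = (ennreal N)\<^sup>2"
    unfolding N(1)[symmetric] Lp_norm_2_power2 by (simp add: ennreal_power)
  also have "(ennreal N)\<^sup>2 * emeasure M A \<le> (ennreal N)\<^sup>2 * ennreal m"
    using m by (intro mult_left_mono) auto
  also have "\<dots> = (ennreal (sqrt m * N))\<^sup>2"
    using N m by (simp add: ennreal_power ennreal_mult[symmetric] power_mult_distrib mult.commute)
  finally show "(\<integral>\<^sup>+ x\<in>A. norm (f x) \<partial>M)\<^sup>2 \<le> (ennreal (sqrt m * N))\<^sup>2" .
qed (use N m in simp)

text \<open>The radius is chosen so that the first term of the bound absorbs half of the left-hand side.\<close>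

lemma absorb_by_radius:
  fixes u m \<kappa> p q N W :: real
  assumes pos: "0 < u" "0 < m" "0 < \<kappa>" "0 < p"
    and le: "\<And>R. 0 < R \<Longrightarrow> u * N \<le> m * (\<kappa> * R powr p * N + R powr (- q) * W)"
  shows "u powr (1 + q / p) * N \<le> 2 * (2 * \<kappa>) powr (q / p) * m powr (1 + q / p) * W"
proof -
  \<comment> \<open>This is the value of \<open>R powr p\<close> solving
    \<open>m * \<kappa> * t = u / 2\<close>.\<close>
  define t where "t = u / (2 * m * \<kappa>)"
  have t: "0 < t" using pos by (simp add: t_def)
  have "u * N \<le> m * (\<kappa> * t * N + t powr (- (q / p)) * W)"
    using le[of "t powr (1 / p)"] t pos by (simp add: powr_powr)
  also have "\<dots> = u * N / 2 + m * (t powr (- (q / p)) * W)"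
    using pos by (simp add: t_def field_simps)
  finally have *: "u * N \<le> 2 * m * (t powr (- (q / p)) * W)" by simp
  have "u powr (1 + q / p) * N = u powr (q / p) * (u * N)"
    using pos by (simp add: powr_add)
  also have "\<dots> \<le> u powr (q / p) * (2 * m * (t powr (- (q / p)) * W))"
    using * by (rule mult_left_mono) simp
  also have "t powr (- (q / p)) = (2 * \<kappa>) powr (q / p) * m powr (q / p) / u powr (q / p)"
    using pos by (simp add: t_def powr_minus powr_divide powr_mult field_simps)
  also have "u powr (q / p) * (2 * m * ((2 * \<kappa>) powr (q / p) * m powr (q / p) / u powr (q / p) * W)) =
      2 * (2 * \<kappa>) powr (q / p) * m powr (1 + q / p) * W"
    using pos by (simp add: powr_add)
  finally show ?thesis .
qed

lemma nn_integral_split_set: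
  fixes h :: "'a \<Rightarrow> ennreal"
  assumes [measurable]: "h \<in> borel_measurable M" "A \<in> sets M"
  shows "(\<integral>\<^sup>+ x. h x \<partial>M) = (\<integral>\<^sup>+ x\<in>A. h x \<partial>M) + (\<integral>\<^sup>+ x\<in>space M - A. h x \<partial>M)"
proof -
  have "(\<integral>\<^sup>+ x. h x \<partial>M) = (\<integral>\<^sup>+ x. h x * indicator A x + h x * indicator (space M - A) x \<partial>M)"
    by (intro nn_integral_cong) (auto simp: indicator_def)
  also have "\<dots> = (\<integral>\<^sup>+ x\<in>A. h x \<partial>M) + (\<integral>\<^sup>+ x\<in>space M - A. h x \<partial>M)"
    by (intro nn_integral_add) measurable
  finally show ?thesis .
qed

text \<open>Inside \<open>S\<close> the L1 norm is estimated by Cauchy-Schwarz, outside by time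
  limitation; since \<open>N1\<close> is finite, \<open>\<epsilon> * N1\<close> can be moved to the
  left.\<close>

lemma timelimited_bound:
  fixes f :: "'a \<Rightarrow> complex"
  assumes tl: "timelimited M \<epsilon> S f" and f2: "f \<in> Lp_space 2 M"
    and S: "S \<in> sets M" "emeasure M S < \<infinity>" and \<epsilon>: "0 \<le> \<epsilon>"
    and N1: "Lp_norm 1 M f = ennreal N1" "0 \<le> N1"
    and N2: "Lp_norm 2 M f = ennreal N2" "0 \<le> N2"
  shows "(1 - \<epsilon>) * N1 \<le> sqrt (measure M S) * N2"
proof -
  note [measurable] = S(1)
  have [measurable]: "f \<in> borel_measurable M" using f2 by (simp add: Lp_space_2_iff)
  have "ennreal N1 = (\<integral>\<^sup>+ x\<in>S. norm (f x) \<partial>M) + (\<integral>\<^sup>+ x\<in>space M - S. norm (f x) \<partial>M)"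
    unfolding N1(1)[symmetric] Lp_norm_1 by (rule nn_integral_split_set) measurable
  also have "\<dots> \<le> ennreal (sqrt (measure M S) * N2) + ennreal \<epsilon> * ennreal N1"
  proof (rule add_mono)
    show "(\<integral>\<^sup>+ x\<in>S. norm (f x) \<partial>M) \<le> ennreal (sqrt (measure M S) * N2)"
      using S N2 by (intro set_nn_integral_le_L2) (auto simp: emeasure_eq_ennreal_measure)
    have "(\<integral>\<^sup>+ x\<in>space M - S. norm (f x) \<partial>M) = Lp_norm 1 M (time_proj (space M - S) f)"
      unfolding Lp_norm_1 time_proj_def by (intro nn_integral_cong) (auto simp: indicator_def)
    then show "(\<integral>\<^sup>+ x\<in>space M - S. norm (f x) \<partial>M) \<le> ennreal \<epsilon> * ennreal N1"
      using tl N1 by (simp add: timelimited_def)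
  qed
  also have "\<dots> = ennreal (sqrt (measure M S) * N2 + \<epsilon> * N1)"
    using N1 N2 \<epsilon> by (simp add: ennreal_mult)
  finally have "N1 \<le> sqrt (measure M S) * N2 + \<epsilon> * N1"
    using N1 N2 \<epsilon> by (simp add: ennreal_plus[symmetric] del: ennreal_plus)
  then show ?thesis by (simp add: algebra_simps)
qed

lemma Lp_norm_eq_0_iff:
  assumes "f \<in> Lp_space p M" "p = 1 \<or> p = 2"
  shows "Lp_norm p M f = 0 \<longleftrightarrow> (AE x in M. f x = 0)"
proof -
  have [measurable]: "f \<in> borel_measurable M" using assms by (auto simp: Lp_space_def)
  have "Lp_norm 2 M f = 0 \<longleftrightarrow> (Lp_norm 2 M f)\<^sup>2 = 0" by simp
  then have 2: "Lp_norm 2 M f = 0 \<longleftrightarrow> (AE x in M. f x = 0)"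
    unfolding Lp_norm_2_power2 by (subst (asm) nn_integral_0_iff_AE) auto
  have 1: "Lp_norm 1 M f = 0 \<longleftrightarrow> (AE x in M. f x = 0)"
    unfolding Lp_norm_1 by (subst nn_integral_0_iff_AE) auto
  from 1 2 assms(2) show ?thesis by auto
qed

lemma norm_weighted: "norm (weighted s f x) = norm x powr s * norm (f x)"
  by (simp add: weighted_def norm_mult)

section \<open>Bounds on the transform and radial splitting\<close>

context cone_transform
begin

lemma int_op_bound_AE:
  assumes c: "\<And>x \<xi>. x \<in> \<Omega> \<Longrightarrow> \<xi> \<in> \<Omega> \<Longrightarrow> norm (K x \<xi>) \<le> c"
    and f: "f \<in> Lp_space 1 \<mu> \<inter> Lp_space 2 \<mu>"
    and N1: "Lp_norm 1 \<mu> f = ennreal N1" "0 \<le> N1"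
  shows "AE \<xi> in \<mu>. norm (T2 f \<xi>) \<le> c * N1"
proof -
  have f1: "integrable \<mu> f" using f by (simp add: Lp_space_1_iff)
  then have "ennreal (\<integral> x. norm (f x) \<partial>\<mu>) = ennreal N1"
    using N1 by (simp add: Lp_norm_1 nn_integral_eq_integral)
  then have "(\<integral> x. norm (f x) \<partial>\<mu>) = N1" using N1 by simp
  with T2_eq_int_op[OF f] int_op_bound[OF c f1] show ?thesis
    by (auto simp: space_mu intro: AE_mp[OF _ AE_I2])
qed

text \<open>Squared norms inside and outside \<open>\<Sigma>\<close> add up, whence
  \<open>1 - \<epsilon>\<^sup>2\<close> instead of the \<open>1 - \<epsilon>\<close> of time
  limitation. Outside, the inverse is an isometry, so the band projection has the norm of the
  truncated \<open>T2 f\<close>; inside, \<open>T2 f\<close> is at most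
  \<open>c * N1\<close>.\<close>

lemma band_projection_bound:
  assumes bl: "bandlimited \<mu> T2 \<epsilon> \<Sigma> f" and f: "f \<in> Lp_space 1 \<mu> \<inter> Lp_space 2 \<mu>"
    and \<Sigma>: "\<Sigma> \<in> sets \<mu>" "emeasure \<mu> \<Sigma> < \<infinity>" and \<epsilon>: "0 \<le> \<epsilon>" "\<epsilon> < 1"
    and c: "0 < c" "\<And>x \<xi>. x \<in> \<Omega> \<Longrightarrow> \<xi> \<in> \<Omega> \<Longrightarrow> norm (K x \<xi>) \<le> c"
    and N1: "Lp_norm 1 \<mu> f = ennreal N1" "0 \<le> N1"
    and N2: "Lp_norm 2 \<mu> f = ennreal N2" "0 \<le> N2"
  shows "sqrt (1 - \<epsilon>\<^sup>2) * N2 \<le> c * sqrt (measure \<mu> \<Sigma>) * N1"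
proof -
  note [measurable] = \<Sigma>(1)
  have T2f: "T2 f \<in> Lp_space 2 \<mu>" using T2_unitary f by (auto simp: L2_unitary_def)
  then have [measurable]: "T2 f \<in> borel_measurable \<mu>" by (simp add: Lp_space_2_iff)
  let ?g = "\<lambda>\<xi>. indicator (space \<mu> - \<Sigma>) \<xi> * T2 f \<xi>"
  have "integrable \<mu> (\<lambda>\<xi>. (norm (T2 f \<xi>))\<^sup>2)" using T2f by (simp add: Lp_space_2_iff)
  then have "integrable \<mu> (\<lambda>\<xi>. (norm (?g \<xi>))\<^sup>2)"
    by (rule Bochner_Integration.integrable_bound) (auto simp: indicator_def)
  then have g: "?g \<in> Lp_space 2 \<mu>" by (simp add: Lp_space_2_iff)
  have "Lp_norm 2 \<mu> ?g \<le> ennreal \<epsilon> * ennreal N2"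
    using bl N2 L2_inv_isometry[OF T2_unitary g] by (simp add: bandlimited_def band_proj_def)
  then have "(Lp_norm 2 \<mu> ?g)\<^sup>2 \<le> (ennreal \<epsilon> * ennreal N2)\<^sup>2" by (rule power_mono) simp
  then have out: "(\<integral>\<^sup>+ \<xi>\<in>space \<mu> - \<Sigma>. (norm (T2 f \<xi>))\<^sup>2 \<partial>\<mu>) \<le> ennreal (\<epsilon>\<^sup>2 * N2\<^sup>2)"
    unfolding Lp_norm_2_power2 using \<epsilon> N2
    by (simp add: ennreal_mult[symmetric] ennreal_power power_mult_distrib norm_mult)
       (erule order_trans[rotated], intro nn_integral_mono, auto simp: indicator_def)
  have "ennreal (N2\<^sup>2) = (Lp_norm 2 \<mu> f)\<^sup>2" using N2 by (simp add: ennreal_power)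
  also have "\<dots> = (\<integral>\<^sup>+ \<xi>. (norm (T2 f \<xi>))\<^sup>2 \<partial>\<mu>)"
    unfolding Lp_norm_2_power2 using L2_unitary_isometry_nn[OF T2_unitary] f by simp
  also have "\<dots> = (\<integral>\<^sup>+ \<xi>\<in>\<Sigma>. (norm (T2 f \<xi>))\<^sup>2 \<partial>\<mu>) + (\<integral>\<^sup>+ \<xi>\<in>space \<mu> - \<Sigma>. (norm (T2 f \<xi>))\<^sup>2 \<partial>\<mu>)"
    by (rule nn_integral_split_set) measurable
  also have "\<dots> \<le> ennreal ((c * N1)\<^sup>2 * measure \<mu> \<Sigma>) + ennreal (\<epsilon>\<^sup>2 * N2\<^sup>2)"
  proof (rule add_mono[OF _ out])
    have "(\<integral>\<^sup>+ \<xi>\<in>\<Sigma>. (norm (T2 f \<xi>))\<^sup>2 \<partial>\<mu>) \<le> (\<integral>\<^sup>+ \<xi>. ennreal ((c * N1)\<^sup>2) * indicator \<Sigma> \<xi> \<partial>\<mu>)"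
      using int_op_bound_AE[OF c(2) f N1]
      by (intro nn_integral_mono_AE) (auto elim!: eventually_mono intro!: mult_right_mono ennreal_leI power_mono)
    also have "\<dots> = ennreal ((c * N1)\<^sup>2) * ennreal (measure \<mu> \<Sigma>)"
      using \<Sigma> by (simp add: nn_integral_cmult_indicator emeasure_eq_ennreal_measure)
    finally show "(\<integral>\<^sup>+ \<xi>\<in>\<Sigma>. (norm (T2 f \<xi>))\<^sup>2 \<partial>\<mu>) \<le> ennreal ((c * N1)\<^sup>2 * measure \<mu> \<Sigma>)"
      by (simp add: ennreal_mult)
  qed
  also have "\<dots> = ennreal ((c * N1)\<^sup>2 * measure \<mu> \<Sigma> + \<epsilon>\<^sup>2 * N2\<^sup>2)" by simp
  finally have "N2\<^sup>2 \<le> (c * N1)\<^sup>2 * measure \<mu> \<Sigma> + \<epsilon>\<^sup>2 * N2\<^sup>2"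
    by (subst (asm) ennreal_le_iff) auto
  then have "(1 - \<epsilon>\<^sup>2) * N2\<^sup>2 \<le> (c * N1)\<^sup>2 * measure \<mu> \<Sigma>" by (simp add: algebra_simps)
  moreover have "\<epsilon>\<^sup>2 \<le> 1" using \<epsilon> by (simp add: power_le_one)
  ultimately have "(sqrt (1 - \<epsilon>\<^sup>2) * N2)\<^sup>2 \<le> (c * sqrt (measure \<mu> \<Sigma>) * N1)\<^sup>2"
    by (simp add: power_mult_distrib mult_ac)
  then show ?thesis by (rule power2_le_imp_le) (use c N1 in simp)
qed

text \<open>Off the ball \<open>R powr (- q) * norm x powr q\<close> is at least 1. A general
  \<open>h\<close> covers the square of the transform with exponent \<open>2 * \<beta>\<close> as
  well as the norm of \<open>f\<close> with exponent \<open>s\<close>.\<close>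

lemma nn_integral_radial_split:
  assumes [measurable]: "h \<in> borel_measurable \<mu>" and h: "\<And>x. 0 \<le> h x" and R: "0 < R" and q: "0 < q"
  shows "(\<integral>\<^sup>+ x. ennreal (h x) \<partial>\<mu>) \<le> (\<integral>\<^sup>+ x\<in>\<Omega> \<inter> cball 0 R. ennreal (h x) \<partial>\<mu>) +
    ennreal (R powr (- q)) * (\<integral>\<^sup>+ x. ennreal (norm x powr q * h x) \<partial>\<mu>)"
proof -
  have [measurable]: "\<Omega> \<inter> cball 0 R \<in> sets \<mu>"
    by (auto simp: sets_mu sets_restrict_space)
  have "(\<integral>\<^sup>+ x. ennreal (h x) \<partial>\<mu>) \<le> (\<integral>\<^sup>+ x. ennreal (h x) * indicator (\<Omega> \<inter> cball 0 R) x +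
      ennreal (R powr (- q)) * ennreal (norm x powr q * h x) \<partial>\<mu>)"
  proof (rule nn_integral_mono)
    fix x assume x: "x \<in> space \<mu>"
    show "ennreal (h x) \<le> ennreal (h x) * indicator (\<Omega> \<inter> cball 0 R) x +
        ennreal (R powr (- q)) * ennreal (norm x powr q * h x)"
    proof (cases "norm x \<le> R")
      case True
      with x show ?thesis by (simp add: space_mu)
    next
      case False
      then have "R powr q \<le> norm x powr q" using R q by (intro powr_mono2) auto
      then have "1 \<le> R powr (- q) * norm x powr q"
        using R by (simp add: powr_minus field_simps)
      then have "h x \<le> R powr (- q) * (norm x powr q * h x)"
        using mult_right_mono[OF _ h[of x]] by (fastforce simp: mult_ac)
      then have "ennreal (h x) \<le> ennreal (R powr (- q)) * ennreal (norm x powr q * h x)"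
        using h[of x] by (subst ennreal_mult[symmetric]) (auto intro: ennreal_leI)
      also have "\<dots> \<le> ennreal (h x) * indicator (\<Omega> \<inter> cball 0 R) x +
        ennreal (R powr (- q)) * ennreal (norm x powr q * h x)" by simp
      finally show ?thesis .
    qed
  qed
  also have "\<dots> = (\<integral>\<^sup>+ x\<in>\<Omega> \<inter> cball 0 R. ennreal (h x) \<partial>\<mu>) +
    (\<integral>\<^sup>+ x. ennreal (R powr (- q)) * ennreal (norm x powr q * h x) \<partial>\<mu>)"
    by (rule nn_integral_add) measurable
  also have "(\<integral>\<^sup>+ x. ennreal (R powr (- q)) * ennreal (norm x powr q * h x) \<partial>\<mu>) =
    ennreal (R powr (- q)) * (\<integral>\<^sup>+ x. ennreal (norm x powr q * h x) \<partial>\<mu>)"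
    by (rule nn_integral_cmult) measurable
  finally show ?thesis .
qed

lemma L2_radial_bound:
  assumes f: "f \<in> Lp_space 1 \<mu> \<inter> Lp_space 2 \<mu>" and \<beta>: "0 < \<beta>" and R: "0 < R"
    and c: "0 < c" "\<And>x \<xi>. x \<in> \<Omega> \<Longrightarrow> \<xi> \<in> \<Omega> \<Longrightarrow> norm (K x \<xi>) \<le> c"
    and \<kappa>: "0 < \<kappa>" "\<And>R. 0 < R \<Longrightarrow> emeasure \<mu> (\<Omega> \<inter> cball 0 R) \<le> ennreal (\<kappa> * R powr (2 * a))"
    and N1: "Lp_norm 1 \<mu> f = ennreal N1" "0 \<le> N1"
    and N2: "Lp_norm 2 \<mu> f = ennreal N2" "0 \<le> N2"
    and W: "Lp_norm 2 \<mu> (weighted \<beta> (int_op \<mu> K f)) = ennreal W" "0 \<le> W"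
  shows "N2\<^sup>2 \<le> c\<^sup>2 * \<kappa> * R powr (2 * a) * N1\<^sup>2 + R powr (- (2 * \<beta>)) * W\<^sup>2"
proof -
  have "T2 f \<in> Lp_space 2 \<mu>" using T2_unitary f by (auto simp: L2_unitary_def)
  then have [measurable]: "T2 f \<in> borel_measurable \<mu>" by (simp add: Lp_space_2_iff)
  have B [measurable]: "\<Omega> \<inter> cball 0 R \<in> sets \<mu>"
    by (auto simp: sets_mu sets_restrict_space)
  have "ennreal (W\<^sup>2) = (\<integral>\<^sup>+ \<xi>. (norm (weighted \<beta> (int_op \<mu> K f) \<xi>))\<^sup>2 \<partial>\<mu>)"
    unfolding Lp_norm_2_power2[symmetric] W(1) using W(2) by (simp add: ennreal_power)
  \<comment> \<open>Almost everywhere agreement replaces the integral operator by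
    \<open>T2 f\<close>; squaring doubles the exponent of the weight.\<close>
  also have "\<dots> = (\<integral>\<^sup>+ \<xi>. ennreal (norm \<xi> powr (2 * \<beta>) * (norm (T2 f \<xi>))\<^sup>2) \<partial>\<mu>)"
    using T2_eq_int_op[OF f]
    by (intro nn_integral_cong_AE)
       (auto elim!: eventually_mono simp: norm_weighted power_mult_distrib power2_eq_square powr_add[symmetric])
  finally have W2: "(\<integral>\<^sup>+ \<xi>. ennreal (norm \<xi> powr (2 * \<beta>) * (norm (T2 f \<xi>))\<^sup>2) \<partial>\<mu>) = ennreal (W\<^sup>2)" ..
  have "ennreal (N2\<^sup>2) = (Lp_norm 2 \<mu> f)\<^sup>2" using N2 by (simp add: ennreal_power)
  also have "\<dots> = (\<integral>\<^sup>+ \<xi>. (norm (T2 f \<xi>))\<^sup>2 \<partial>\<mu>)"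
    unfolding Lp_norm_2_power2 using L2_unitary_isometry_nn[OF T2_unitary] f by simp
  also have "\<dots> \<le> (\<integral>\<^sup>+ \<xi>\<in>\<Omega> \<inter> cball 0 R. (norm (T2 f \<xi>))\<^sup>2 \<partial>\<mu>) +
      ennreal (R powr (- (2 * \<beta>))) * ennreal (W\<^sup>2)"
    unfolding W2[symmetric] using R \<beta> by (intro nn_integral_radial_split) auto
  also have "(\<integral>\<^sup>+ \<xi>\<in>\<Omega> \<inter> cball 0 R. (norm (T2 f \<xi>))\<^sup>2 \<partial>\<mu>) \<le>
      (\<integral>\<^sup>+ \<xi>. ennreal ((c * N1)\<^sup>2) * indicator (\<Omega> \<inter> cball 0 R) \<xi> \<partial>\<mu>)"
    using int_op_bound_AE[OF c(2) f N1]
    by (intro nn_integral_mono_AE) (auto elim!: eventually_mono intro!: mult_right_mono ennreal_leI power_mono)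
  also have "\<dots> = ennreal ((c * N1)\<^sup>2) * emeasure \<mu> (\<Omega> \<inter> cball 0 R)"
    by (rule nn_integral_cmult_indicator) measurable
  also have "\<dots> \<le> ennreal ((c * N1)\<^sup>2) * ennreal (\<kappa> * R powr (2 * a))"
    by (intro mult_left_mono \<kappa>(2) R) simp
  finally have "ennreal (N2\<^sup>2) \<le> ennreal ((c * N1)\<^sup>2) * ennreal (\<kappa> * R powr (2 * a)) +
      ennreal (R powr (- (2 * \<beta>))) * ennreal (W\<^sup>2)"
    by (simp add: add_right_mono)
  also have "\<dots> = ennreal ((c * N1)\<^sup>2 * (\<kappa> * R powr (2 * a)) + R powr (- (2 * \<beta>)) * W\<^sup>2)"
    using \<kappa>(1) by (simp add: ennreal_mult)
  finally have "N2\<^sup>2 \<le> (c * N1)\<^sup>2 * (\<kappa> * R powr (2 * a)) + R powr (- (2 * \<beta>)) * W\<^sup>2"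
    using \<kappa>(1) by (subst (asm) ennreal_le_iff) auto
  then show ?thesis by (simp add: power_mult_distrib mult_ac)
qed

text \<open>Inside the ball Cauchy-Schwarz brings in the square root of its measure, hence
  \<open>R powr a\<close> in place of \<open>R powr (2 * a)\<close>.\<close>

lemma L1_radial_bound:
  assumes f: "f \<in> Lp_space 1 \<mu> \<inter> Lp_space 2 \<mu>" and s: "0 < s" and R: "0 < R"
    and \<kappa>: "0 < \<kappa>" "\<And>R. 0 < R \<Longrightarrow> emeasure \<mu> (\<Omega> \<inter> cball 0 R) \<le> ennreal (\<kappa> * R powr (2 * a))"
    and N1: "Lp_norm 1 \<mu> f = ennreal N1" "0 \<le> N1"
    and N2: "Lp_norm 2 \<mu> f = ennreal N2" "0 \<le> N2"
    and W: "Lp_norm 1 \<mu> (weighted s f) = ennreal W" "0 \<le> W"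
  shows "N1 \<le> sqrt \<kappa> * R powr a * N2 + R powr (- s) * W"
proof -
  have [measurable]: "f \<in> borel_measurable \<mu>" using f by (simp add: Lp_space_2_iff)
  have B [measurable]: "\<Omega> \<inter> cball 0 R \<in> sets \<mu>"
    by (auto simp: sets_mu sets_restrict_space)
  have "ennreal N1 = (\<integral>\<^sup>+ x. norm (f x) \<partial>\<mu>)"
    unfolding N1(1)[symmetric] Lp_norm_1 ..
  also have "\<dots> \<le> (\<integral>\<^sup>+ x\<in>\<Omega> \<inter> cball 0 R. norm (f x) \<partial>\<mu>) +
      ennreal (R powr (- s)) * (\<integral>\<^sup>+ x. ennreal (norm x powr s * norm (f x)) \<partial>\<mu>)"
    using R s by (intro nn_integral_radial_split) auto
  also have "(\<integral>\<^sup>+ x. ennreal (norm x powr s * norm (f x)) \<partial>\<mu>) = ennreal W"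
    unfolding W(1)[symmetric] Lp_norm_1 norm_weighted ..
  also have "(\<integral>\<^sup>+ x\<in>\<Omega> \<inter> cball 0 R. norm (f x) \<partial>\<mu>) \<le> ennreal (sqrt (\<kappa> * R powr (2 * a)) * N2)"
    using \<kappa> R N2 by (intro set_nn_integral_le_L2) auto
  finally have "ennreal N1 \<le> ennreal (sqrt (\<kappa> * R powr (2 * a)) * N2) + ennreal (R powr (- s)) * ennreal W"
    by (simp add: add_right_mono)
  also have "\<dots> = ennreal (sqrt (\<kappa> * R powr (2 * a)) * N2 + R powr (- s) * W)"
    using \<kappa>(1) N2 W by (simp add: ennreal_mult)
  finally have "N1 \<le> sqrt (\<kappa> * R powr (2 * a)) * N2 + R powr (- s) * W"
    using \<kappa>(1) N2 W by (subst (asm) ennreal_le_iff) auto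
  moreover have "sqrt (R powr (2 * a)) = R powr a"
    using R by (simp add: powr_half_sqrt[symmetric] powr_powr)
  ultimately show ?thesis by (simp add: real_sqrt_mult)
qed

section \<open>The time and band inequalities for finite weighted norms\<close>

text \<open>The argument runs on squares: \<open>absorb_by_radius\<close> is applied to the squares
  of \<open>1 - \<epsilon>\<close>, \<open>N1\<close> and \<open>W\<close> with exponents
  \<open>2 * a\<close> and \<open>2 * \<beta>\<close>, and a square root is taken at the
  end.\<close>

lemma time_uncertainty:
  assumes \<beta>: "0 < \<beta>" and \<epsilon>: "0 \<le> \<epsilon>" "\<epsilon> < 1"
  obtains D where "0 < D"
    "\<And>S f N1 W. \<lbrakk>S \<in> sets \<mu>; f \<in> Lp_space 1 \<mu> \<inter> Lp_space 2 \<mu>; 0 < emeasure \<mu> S; emeasure \<mu> S < \<infinity>;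
      timelimited \<mu> \<epsilon> S f; Lp_norm 1 \<mu> f = ennreal N1; 0 \<le> N1;
      Lp_norm 2 \<mu> (weighted \<beta> (int_op \<mu> K f)) = ennreal W; 0 \<le> W\<rbrakk> \<Longrightarrow>
      (1 - \<epsilon>) powr ((a + \<beta>) / a) * N1 \<le> D * measure \<mu> S powr ((a + \<beta>) / (2 * a)) * W"
proof -
  obtain c where c: "0 < c" "\<And>x \<xi>. x \<in> \<Omega> \<Longrightarrow> \<xi> \<in> \<Omega> \<Longrightarrow> norm (K x \<xi>) \<le> c"
    using K_bound by blast
  obtain \<kappa> where \<kappa>: "0 < \<kappa>"
    "\<And>R. 0 < R \<Longrightarrow> emeasure \<mu> (\<Omega> \<inter> cball 0 R) \<le> ennreal (\<kappa> * R powr (2 * a))"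
    using emeasure_cball_le by blast
  \<comment> \<open>The constant of \<open>absorb_by_radius\<close> with
    \<open>c\<^sup>2 * \<kappa>\<close> for \<open>\<kappa>\<close> and \<open>\<beta> / a\<close>
    for the quotient of the exponents.\<close>
  define E where "E = 2 * (2 * (c\<^sup>2 * \<kappa>)) powr (\<beta> / a)"
  have E: "0 < E" using c \<kappa> by (simp add: E_def)
  show thesis
  proof (rule that[of "sqrt E"])
    fix S f N1 W
    assume S: "S \<in> sets \<mu>" "0 < emeasure \<mu> S" "emeasure \<mu> S < \<infinity>"
      and f: "f \<in> Lp_space 1 \<mu> \<inter> Lp_space 2 \<mu>" and tl: "timelimited \<mu> \<epsilon> S f"
      and N1: "Lp_norm 1 \<mu> f = ennreal N1" "0 \<le> N1"
      and W: "Lp_norm 2 \<mu> (weighted \<beta> (int_op \<mu> K f)) = ennreal W" "0 \<le> W"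
    define m where "m = measure \<mu> S"
    have m: "0 < m" using S by (simp add: m_def emeasure_eq_ennreal_measure)
    obtain N2 where N2: "Lp_norm 2 \<mu> f = ennreal N2" "0 \<le> N2"
      using f by (cases "Lp_norm 2 \<mu> f") (auto simp: Lp_space_def)
    have "(1 - \<epsilon>) * N1 \<le> sqrt m * N2"
      unfolding m_def using timelimited_bound[OF tl _ S(1,3) \<epsilon>(1) N1 N2] f by simp
    then have "((1 - \<epsilon>) * N1)\<^sup>2 \<le> (sqrt m * N2)\<^sup>2"
      using \<epsilon> N1 by (intro power_mono) auto
    then have "(1 - \<epsilon>)\<^sup>2 * N1\<^sup>2 \<le> m * N2\<^sup>2" using m by (simp add: power_mult_distrib)
    also have "\<dots> \<le> m * (c\<^sup>2 * \<kappa> * R powr (2 * a) * N1\<^sup>2 + R powr (- (2 * \<beta>)) * W\<^sup>2)" if "0 < R" for R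
      using L2_radial_bound[OF f \<beta> that c \<kappa> N1 N2 W] m by (intro mult_left_mono) auto
    finally have "((1 - \<epsilon>)\<^sup>2) powr (1 + 2 * \<beta> / (2 * a)) * N1\<^sup>2 \<le>
        2 * (2 * (c\<^sup>2 * \<kappa>)) powr (2 * \<beta> / (2 * a)) * m powr (1 + 2 * \<beta> / (2 * a)) * W\<^sup>2"
      using \<epsilon> m c \<kappa> a_pos by (intro absorb_by_radius) auto
    then have "((1 - \<epsilon>)\<^sup>2) powr ((a + \<beta>) / a) * N1\<^sup>2 \<le> E * m powr ((a + \<beta>) / a) * W\<^sup>2"
      using a_pos by (simp add: E_def add_divide_distrib)
    moreover have "((1 - \<epsilon>)\<^sup>2) powr ((a + \<beta>) / a) = ((1 - \<epsilon>) powr ((a + \<beta>) / a))\<^sup>2"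
      using \<epsilon> by (simp add: power2_eq_square powr_mult)
    moreover have "m powr ((a + \<beta>) / a) = (m powr ((a + \<beta>) / (2 * a)))\<^sup>2"
      by (simp add: power2_eq_square powr_add[symmetric] field_simps)
    ultimately have "((1 - \<epsilon>) powr ((a + \<beta>) / a) * N1)\<^sup>2 \<le> (sqrt E * m powr ((a + \<beta>) / (2 * a)) * W)\<^sup>2"
      using E by (simp add: power_mult_distrib)
    then show "(1 - \<epsilon>) powr ((a + \<beta>) / a) * N1 \<le> sqrt E * measure \<mu> S powr ((a + \<beta>) / (2 * a)) * W"
      unfolding m_def[symmetric] by (rule power2_le_imp_le) (use E W in simp)
  qed (use E in simp)
qed

text \<open>Here the norms enter unsquared: \<open>absorb_by_radius\<close> is applied with
  \<open>u = sqrt (1 - \<epsilon>\<^sup>2)\<close>, with \<open>c * sqrt m\<close> for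
  \<open>m\<close>, and with exponents \<open>a\<close> and \<open>s\<close>.\<close>

lemma band_uncertainty:
  assumes s: "0 < s" and \<epsilon>: "0 \<le> \<epsilon>" "\<epsilon> < 1"
  obtains D where "0 < D"
    "\<And>\<Sigma> f N2 W. \<lbrakk>\<Sigma> \<in> sets \<mu>; f \<in> Lp_space 1 \<mu> \<inter> Lp_space 2 \<mu>; 0 < emeasure \<mu> \<Sigma>; emeasure \<mu> \<Sigma> < \<infinity>;
      bandlimited \<mu> T2 \<epsilon> \<Sigma> f; Lp_norm 2 \<mu> f = ennreal N2; 0 \<le> N2;
      Lp_norm 1 \<mu> (weighted s f) = ennreal W; 0 \<le> W\<rbrakk> \<Longrightarrow>
      (1 - \<epsilon>\<^sup>2) powr ((a + s) / (2 * a)) * N2 \<le> D * measure \<mu> \<Sigma> powr ((a + s) / (2 * a)) * W"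
proof -
  obtain c where c: "0 < c" "\<And>x \<xi>. x \<in> \<Omega> \<Longrightarrow> \<xi> \<in> \<Omega> \<Longrightarrow> norm (K x \<xi>) \<le> c"
    using K_bound by blast
  obtain \<kappa> where \<kappa>: "0 < \<kappa>"
    "\<And>R. 0 < R \<Longrightarrow> emeasure \<mu> (\<Omega> \<inter> cball 0 R) \<le> ennreal (\<kappa> * R powr (2 * a))"
    using emeasure_cball_le by blast
  \<comment> \<open>The last factor is split off from the power of
    \<open>c * sqrt m\<close>.\<close>
  define D where "D = 2 * (2 * sqrt \<kappa>) powr (s / a) * c powr ((a + s) / a)"
  have D: "0 < D" using c \<kappa> by (simp add: D_def)
  have \<epsilon>2: "\<epsilon>\<^sup>2 < 1" using \<epsilon> by (simp add: power_less_one_iff)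
  have sqrt_powr: "sqrt t powr ((a + s) / a) = t powr ((a + s) / (2 * a))" if "0 \<le> t" for t
    using that by (simp add: powr_half_sqrt[symmetric] powr_powr)
  show thesis
  proof (rule that[OF D])
    fix \<Sigma> f N2 W
    assume \<Sigma>: "\<Sigma> \<in> sets \<mu>" "0 < emeasure \<mu> \<Sigma>" "emeasure \<mu> \<Sigma> < \<infinity>"
      and f: "f \<in> Lp_space 1 \<mu> \<inter> Lp_space 2 \<mu>" and bl: "bandlimited \<mu> T2 \<epsilon> \<Sigma> f"
      and N2: "Lp_norm 2 \<mu> f = ennreal N2" "0 \<le> N2"
      and W: "Lp_norm 1 \<mu> (weighted s f) = ennreal W" "0 \<le> W"
    define m where "m = measure \<mu> \<Sigma>"
    have m: "0 < m" using \<Sigma> by (simp add: m_def emeasure_eq_ennreal_measure)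
    obtain N1 where N1: "Lp_norm 1 \<mu> f = ennreal N1" "0 \<le> N1"
      using f by (cases "Lp_norm 1 \<mu> f") (auto simp: Lp_space_def)
    have "sqrt (1 - \<epsilon>\<^sup>2) * N2 \<le> c * sqrt m * N1"
      unfolding m_def by (rule band_projection_bound[OF bl f \<Sigma>(1,3) \<epsilon> c N1 N2])
    also have "\<dots> \<le> c * sqrt m * (sqrt \<kappa> * R powr a * N2 + R powr (- s) * W)" if "0 < R" for R
      using L1_radial_bound[OF f s that \<kappa> N1 N2 W] m c by (intro mult_left_mono) auto
    finally have "sqrt (1 - \<epsilon>\<^sup>2) powr (1 + s / a) * N2 \<le>
        2 * (2 * sqrt \<kappa>) powr (s / a) * (c * sqrt m) powr (1 + s / a) * W"
      using \<epsilon>2 m c \<kappa> a_pos by (intro absorb_by_radius) auto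
    moreover have "1 + s / a = (a + s) / a" using a_pos by (simp add: field_simps)
    ultimately show "(1 - \<epsilon>\<^sup>2) powr ((a + s) / (2 * a)) * N2 \<le>
        D * measure \<mu> \<Sigma> powr ((a + s) / (2 * a)) * W"
      unfolding m_def[symmetric] using \<epsilon>2 m c by (simp add: D_def powr_mult sqrt_powr mult_ac)
  qed
qed

end

section \<open>Combination of the two inequalities\<close>

text \<open>To be used with \<open>p = a + s\<close> and \<open>q = a + \<beta>\<close>. Raising the
  first inequality to the power \<open>p\<close> and the second to \<open>q\<close> gives both
  measures the exponent \<open>p * q / (2 * a)\<close>, so the product can be gathered into one
  quotient.\<close>

lemma powr_product_bound:
  fixes x1 x2 n1 n2 m1 m2 w1 w2 D1 D2 p q e :: real
  assumes nonneg: "0 < x1" "0 < x2" "0 \<le> n1" "0 \<le> n2" "0 < m1" "0 < m2" "0 \<le> w1" "0 \<le> w2" "0 < D1" "0 < D2"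
    and pq: "0 < p" "0 < q" "0 < a"
    and 1: "x1 powr (q / a) * n1 \<le> D1 * m1 powr (q / (2 * a)) * w2"
    and 2: "x2 powr (p / (2 * a)) * n2 \<le> D2 * m2 powr (p / (2 * a)) * w1"
  shows "1 / (D1 powr p * D2 powr q) * (x1\<^sup>2 * x2 / (m1 * m2)) powr (p * q / (2 * a)) * n1 powr p * n2 powr q
    \<le> w1 powr q * w2 powr p"
proof -
  define e where "e = p * q / (2 * a)"
  have e: "q * p / a = e * 2" "q * p / (2 * a) = e" "p * q / (2 * a) = e"
    using pq by (simp_all add: e_def field_simps)
  have x1: "x1 powr (e * 2) = (x1\<^sup>2) powr e"
    using nonneg(1) by (simp add: power2_eq_square powr_mult powr_add[symmetric] mult_2_right)
  have "(x1 powr (q / a) * n1) powr p \<le> (D1 * m1 powr (q / (2 * a)) * w2) powr p"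
    using 1 nonneg pq by (intro powr_mono2) auto
  then have 1: "(x1\<^sup>2) powr e * n1 powr p \<le> D1 powr p * m1 powr e * w2 powr p"
    using nonneg by (simp add: powr_mult powr_powr e x1)
  have "(x2 powr (p / (2 * a)) * n2) powr q \<le> (D2 * m2 powr (p / (2 * a)) * w1) powr q"
    using 2 nonneg pq by (intro powr_mono2) auto
  then have 2: "x2 powr e * n2 powr q \<le> D2 powr q * m2 powr e * w1 powr q"
    using nonneg by (simp add: powr_mult powr_powr e)
  have "((x1\<^sup>2) powr e * n1 powr p) * (x2 powr e * n2 powr q) \<le>
      (D1 powr p * m1 powr e * w2 powr p) * (D2 powr q * m2 powr e * w1 powr q)"
    using 1 2 by (rule mult_mono) auto
  then show ?thesis
    unfolding e_def[symmetric] using nonneg by (simp add: powr_mult powr_divide field_simps)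
qed

lemma Lp_norm_finite:
  assumes "f \<in> Lp_space p M"
  obtains N where "Lp_norm p M f = ennreal N" "0 \<le> N"
  using assms by (cases "Lp_norm p M f") (auto simp: Lp_space_def)

theorem corollary3p12:
  fixes \<Omega> :: "'a::euclidean_space set" and a :: real and Q :: "'a \<Rightarrow> real"
    and \<mu> :: "'a measure" and K :: "'a \<Rightarrow> 'a \<Rightarrow> complex"
    and T2 :: "('a \<Rightarrow> complex) \<Rightarrow> 'a \<Rightarrow> complex"
    and s \<beta> \<epsilon>1 \<epsilon>2 :: real
  assumes "cone_transform \<Omega> a Q \<mu> K T2"
    and "0 < s" "0 < \<beta>"
    and "0 < \<epsilon>1" "\<epsilon>1 < 1" "0 < \<epsilon>2" "\<epsilon>2 < 1"
  shows
    "(\<exists>C>0. \<forall>S\<in>sets \<mu>. \<forall>f\<in>Lp_space 1 \<mu> \<inter> Lp_space 2 \<mu>.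
        0 < emeasure \<mu> S \<longrightarrow> emeasure \<mu> S < \<infinity> \<longrightarrow> timelimited \<mu> \<epsilon>1 S f \<longrightarrow>
        emeasure \<mu> S epowr ((a + \<beta>) / (2 * a)) * Lp_norm 2 \<mu> (weighted \<beta> (int_op \<mu> K f))
          \<ge> ennreal (C * (1 - \<epsilon>1) powr ((a + \<beta>) / a)) * Lp_norm 1 \<mu> f) \<and>
     (\<exists>C>0. \<forall>\<Sigma>\<in>sets \<mu>. \<forall>f\<in>Lp_space 1 \<mu> \<inter> Lp_space 2 \<mu>.
        0 < emeasure \<mu> \<Sigma> \<longrightarrow> emeasure \<mu> \<Sigma> < \<infinity> \<longrightarrow> bandlimited \<mu> T2 \<epsilon>2 \<Sigma> f \<longrightarrow>
        emeasure \<mu> \<Sigma> epowr ((a + s) / (2 * a)) * Lp_norm 1 \<mu> (weighted s f)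
          \<ge> ennreal (C * (1 - \<epsilon>2\<^sup>2) powr ((a + s) / (2 * a))) * Lp_norm 2 \<mu> f) \<and>
     (\<exists>C>0. \<forall>S\<in>sets \<mu>. \<forall>\<Sigma>\<in>sets \<mu>. \<forall>f\<in>L1_L2_limited \<mu> T2 \<epsilon>1 \<epsilon>2 S \<Sigma>.
        0 < emeasure \<mu> S \<longrightarrow> emeasure \<mu> S < \<infinity> \<longrightarrow> 0 < emeasure \<mu> \<Sigma> \<longrightarrow> emeasure \<mu> \<Sigma> < \<infinity> \<longrightarrow>
        Lp_norm 1 \<mu> (weighted s f) epowr (a + \<beta>)
          * Lp_norm 2 \<mu> (weighted \<beta> (int_op \<mu> K f)) epowr (a + s)
          \<ge> ennreal (C * (((1 - \<epsilon>1)\<^sup>2 * (1 - \<epsilon>2\<^sup>2)) / (measure \<mu> S * measure \<mu> \<Sigma>))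
                powr ((a + s) * (a + \<beta>) / (2 * a)))
            * Lp_norm 1 \<mu> f epowr (a + s) * Lp_norm 2 \<mu> f epowr (a + \<beta>))"
proof -
  interpret cone_transform \<Omega> a Q \<mu> K T2 by fact
  let ?W1 = "\<lambda>f. Lp_norm 1 \<mu> (weighted s f)"
  let ?W2 = "\<lambda>f. Lp_norm 2 \<mu> (weighted \<beta> (int_op \<mu> K f))"
  have \<epsilon>2: "\<epsilon>2\<^sup>2 < 1" using assms by (simp add: power_less_one_iff)
  obtain D1 where D1: "0 < D1"
    "\<And>S f N1 W. \<lbrakk>S \<in> sets \<mu>; f \<in> Lp_space 1 \<mu> \<inter> Lp_space 2 \<mu>; 0 < emeasure \<mu> S; emeasure \<mu> S < \<infinity>;
      timelimited \<mu> \<epsilon>1 S f; Lp_norm 1 \<mu> f = ennreal N1; 0 \<le> N1; ?W2 f = ennreal W; 0 \<le> W\<rbrakk> \<Longrightarrow>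
      (1 - \<epsilon>1) powr ((a + \<beta>) / a) * N1 \<le> D1 * measure \<mu> S powr ((a + \<beta>) / (2 * a)) * W"
    using time_uncertainty[of \<beta> \<epsilon>1] assms by (metis less_imp_le)
  obtain D2 where D2: "0 < D2"
    "\<And>\<Sigma> f N2 W. \<lbrakk>\<Sigma> \<in> sets \<mu>; f \<in> Lp_space 1 \<mu> \<inter> Lp_space 2 \<mu>; 0 < emeasure \<mu> \<Sigma>; emeasure \<mu> \<Sigma> < \<infinity>;
      bandlimited \<mu> T2 \<epsilon>2 \<Sigma> f; Lp_norm 2 \<mu> f = ennreal N2; 0 \<le> N2; ?W1 f = ennreal W; 0 \<le> W\<rbrakk> \<Longrightarrow>
      (1 - \<epsilon>2\<^sup>2) powr ((a + s) / (2 * a)) * N2 \<le> D2 * measure \<mu> \<Sigma> powr ((a + s) / (2 * a)) * W"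
    using band_uncertainty[of s \<epsilon>2] assms by (metis less_imp_le)
  have measure_pos: "0 < measure \<mu> A" "emeasure \<mu> A = ennreal (measure \<mu> A)"
    if "0 < emeasure \<mu> A" "emeasure \<mu> A < \<infinity>" for A
    using that by (simp_all add: emeasure_eq_ennreal_measure)
  show ?thesis
  proof (intro conjI)
    show "\<exists>C>0. \<forall>S\<in>sets \<mu>. \<forall>f\<in>Lp_space 1 \<mu> \<inter> Lp_space 2 \<mu>.
        0 < emeasure \<mu> S \<longrightarrow> emeasure \<mu> S < \<infinity> \<longrightarrow> timelimited \<mu> \<epsilon>1 S f \<longrightarrow>
        emeasure \<mu> S epowr ((a + \<beta>) / (2 * a)) * ?W2 f
          \<ge> ennreal (C * (1 - \<epsilon>1) powr ((a + \<beta>) / a)) * Lp_norm 1 \<mu> f"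
    proof (intro exI[of _ "1 / D1"] conjI ballI impI)
      fix S f
      assume S: "S \<in> sets \<mu>" "0 < emeasure \<mu> S" "emeasure \<mu> S < \<infinity>"
        and f: "f \<in> Lp_space 1 \<mu> \<inter> Lp_space 2 \<mu>" "timelimited \<mu> \<epsilon>1 S f"
      obtain N1 where N1: "Lp_norm 1 \<mu> f = ennreal N1" "0 \<le> N1" using f Lp_norm_finite by blast
      note m = measure_pos[OF S(2,3)]
      show "ennreal (1 / D1 * (1 - \<epsilon>1) powr ((a + \<beta>) / a)) * Lp_norm 1 \<mu> f
          \<le> emeasure \<mu> S epowr ((a + \<beta>) / (2 * a)) * ?W2 f"
      proof (cases "?W2 f")
        case (real W)
        from D1(2)[OF S(1) f(1) S(2,3) f(2) N1 real(2,1)] have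
          "1 / D1 * (1 - \<epsilon>1) powr ((a + \<beta>) / a) * N1 \<le> measure \<mu> S powr ((a + \<beta>) / (2 * a)) * W"
          using D1(1) by (simp add: field_simps)
        then show ?thesis unfolding N1(1) m(2) real(2)
          using D1(1) N1 real by (simp add: epowr_ennreal ennreal_mult[symmetric] ennreal_leI)
      next
        \<comment> \<open>The measure is positive, so the right-hand side is infinite.\<close>
        case top
        then show ?thesis unfolding m(2) using m(1)
          by (simp add: epowr_ennreal ennreal_mult_top)
      qed
    qed (use D1 in simp)
    show "\<exists>C>0. \<forall>\<Sigma>\<in>sets \<mu>. \<forall>f\<in>Lp_space 1 \<mu> \<inter> Lp_space 2 \<mu>.
        0 < emeasure \<mu> \<Sigma> \<longrightarrow> emeasure \<mu> \<Sigma> < \<infinity> \<longrightarrow> bandlimited \<mu> T2 \<epsilon>2 \<Sigma> f \<longrightarrow>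
        emeasure \<mu> \<Sigma> epowr ((a + s) / (2 * a)) * ?W1 f
          \<ge> ennreal (C * (1 - \<epsilon>2\<^sup>2) powr ((a + s) / (2 * a))) * Lp_norm 2 \<mu> f"
    proof (intro exI[of _ "1 / D2"] conjI ballI impI)
      fix \<Sigma> f
      assume \<Sigma>: "\<Sigma> \<in> sets \<mu>" "0 < emeasure \<mu> \<Sigma>" "emeasure \<mu> \<Sigma> < \<infinity>"
        and f: "f \<in> Lp_space 1 \<mu> \<inter> Lp_space 2 \<mu>" "bandlimited \<mu> T2 \<epsilon>2 \<Sigma> f"
      obtain N2 where N2: "Lp_norm 2 \<mu> f = ennreal N2" "0 \<le> N2" using f Lp_norm_finite by blast
      note m = measure_pos[OF \<Sigma>(2,3)]
      show "ennreal (1 / D2 * (1 - \<epsilon>2\<^sup>2) powr ((a + s) / (2 * a))) * Lp_norm 2 \<mu> f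
          \<le> emeasure \<mu> \<Sigma> epowr ((a + s) / (2 * a)) * ?W1 f"
      proof (cases "?W1 f")
        case (real W)
        from D2(2)[OF \<Sigma>(1) f(1) \<Sigma>(2,3) f(2) N2 real(2,1)] have
          "1 / D2 * (1 - \<epsilon>2\<^sup>2) powr ((a + s) / (2 * a)) * N2 \<le> measure \<mu> \<Sigma> powr ((a + s) / (2 * a)) * W"
          using D2(1) by (simp add: field_simps)
        then show ?thesis unfolding N2(1) m(2) real(2)
          using D2(1) N2 real by (simp add: epowr_ennreal ennreal_mult[symmetric] ennreal_leI)
      next
        case top
        then show ?thesis unfolding m(2) using m(1)
          by (simp add: epowr_ennreal ennreal_mult_top)
      qed
    qed (use D2 in simp)
    show "\<exists>C>0. \<forall>S\<in>sets \<mu>. \<forall>\<Sigma>\<in>sets \<mu>. \<forall>f\<in>L1_L2_limited \<mu> T2 \<epsilon>1 \<epsilon>2 S \<Sigma>.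
        0 < emeasure \<mu> S \<longrightarrow> emeasure \<mu> S < \<infinity> \<longrightarrow> 0 < emeasure \<mu> \<Sigma> \<longrightarrow> emeasure \<mu> \<Sigma> < \<infinity> \<longrightarrow>
        ?W1 f epowr (a + \<beta>) * ?W2 f epowr (a + s)
          \<ge> ennreal (C * (((1 - \<epsilon>1)\<^sup>2 * (1 - \<epsilon>2\<^sup>2)) / (measure \<mu> S * measure \<mu> \<Sigma>))
                powr ((a + s) * (a + \<beta>) / (2 * a)))
            * Lp_norm 1 \<mu> f epowr (a + s) * Lp_norm 2 \<mu> f epowr (a + \<beta>)"
    proof (intro exI[of _ "1 / (D1 powr (a + s) * D2 powr (a + \<beta>))"] conjI ballI impI)
      fix S \<Sigma> f
      assume S: "S \<in> sets \<mu>" "0 < emeasure \<mu> S" "emeasure \<mu> S < \<infinity>"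
        and \<Sigma>: "\<Sigma> \<in> sets \<mu>" "0 < emeasure \<mu> \<Sigma>" "emeasure \<mu> \<Sigma> < \<infinity>"
        and "f \<in> L1_L2_limited \<mu> T2 \<epsilon>1 \<epsilon>2 S \<Sigma>"
      then have f: "f \<in> Lp_space 1 \<mu> \<inter> Lp_space 2 \<mu>"
        "timelimited \<mu> \<epsilon>1 S f" "bandlimited \<mu> T2 \<epsilon>2 \<Sigma> f"
        by (auto simp: L1_L2_limited_def)
      then have nz: "\<not> (AE x in \<mu>. f x = 0)" by (simp add: timelimited_def ae_nonzero_def)
      obtain N1 where N1: "Lp_norm 1 \<mu> f = ennreal N1" "0 \<le> N1" using f Lp_norm_finite by blast
      obtain N2 where N2: "Lp_norm 2 \<mu> f = ennreal N2" "0 \<le> N2" using f Lp_norm_finite by blast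
      have N_pos: "0 < N1" "0 < N2"
        using nz N1 N2 f(1) Lp_norm_eq_0_iff[of f 1 \<mu>] Lp_norm_eq_0_iff[of f 2 \<mu>]
        by (auto simp: less_le)
      note m1 = measure_pos[OF S(2,3)] and m2 = measure_pos[OF \<Sigma>(2,3)]
      note time = D1(2)[OF S(1) f(1) S(2,3) f(2) N1] and band = D2(2)[OF \<Sigma>(1) f(1) \<Sigma>(2,3) f(3) N2]
      \<comment> \<open>A vanishing weighted norm, inserted as \<open>W = 0\<close>, would force
        \<open>N1\<close> or \<open>N2\<close> to be at most 0.\<close>
      have W_pos: "?W2 f \<noteq> 0" "?W1 f \<noteq> 0"
        using time[of 0] band[of 0] N_pos assms \<epsilon>2 by (auto simp: mult_le_0_iff not_le)
      show "ennreal (1 / (D1 powr (a + s) * D2 powr (a + \<beta>)) *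
            (((1 - \<epsilon>1)\<^sup>2 * (1 - \<epsilon>2\<^sup>2)) / (measure \<mu> S * measure \<mu> \<Sigma>)) powr ((a + s) * (a + \<beta>) / (2 * a)))
            * Lp_norm 1 \<mu> f epowr (a + s) * Lp_norm 2 \<mu> f epowr (a + \<beta>)
          \<le> ?W1 f epowr (a + \<beta>) * ?W2 f epowr (a + s)"
      \<comment> \<open>Zero times infinity is zero in \<open>ennreal\<close>; an infinite weighted
        norm makes the product infinite only because the other one is nonzero.\<close>
      proof (cases "?W1 f = top \<or> ?W2 f = top")
        case True
        have "x epowr p \<noteq> 0" if "x \<noteq> 0" for x p
          using that by (cases x) (auto simp: epowr_ennreal)
        with True W_pos show ?thesis by (auto simp: ennreal_mult_top ennreal_top_mult)
      next
        case False
        then obtain w1 w2 where w: "?W1 f = ennreal w1" "0 \<le> w1" "?W2 f = ennreal w2" "0 \<le> w2"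
          by (metis ennreal_cases)
        have "1 / (D1 powr (a + s) * D2 powr (a + \<beta>)) *
            ((1 - \<epsilon>1)\<^sup>2 * (1 - \<epsilon>2\<^sup>2) / (measure \<mu> S * measure \<mu> \<Sigma>)) powr ((a + s) * (a + \<beta>) / (2 * a))
            * N1 powr (a + s) * N2 powr (a + \<beta>) \<le> w1 powr (a + \<beta>) * w2 powr (a + s)"
          using time[OF w(3,4)] band[OF w(1,2)] assms \<epsilon>2 m1 m2 w N1 N2 D1(1) D2(1) a_pos
          by (intro powr_product_bound) auto
        then show ?thesis
          unfolding w(1,3) N1(1) N2(1) using w N1 N2 D1(1) D2(1)
          by (simp add: epowr_ennreal ennreal_mult[symmetric] ennreal_leI)
      qed
    qed (use D1 D2 in simp)
  qed
qed

end
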